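(* Let $(\Omega,\mu)$ be a $\sigma$-finite measure space and let $(H_\xi)_{\xi\in\Omega}$ be a measurable field of non-zero separable complex Hilbert spaces. Let \[ \mathcal{A}=\int^{\oplus}_\Omega \mathcal{B}(H_\xi)\,\mathrm{d}\mu(\xi). \] Then $\mathcal{A}$ is commutative if and only if $\mu(\Omega_2)=0$, where $\Omega_2=\{\xi\in\Omega\colon \dim(H_\xi)\ge 2\}$.
   Context: A measurable field of Hilbert spaces comes with a fundamental sequence of measurable vector fields $(g_j)_{j\in\mathbb{N}}$ such that for every $\xi\in\Omega$ the sequence $(g_j(\xi))_{j\in\mathbb{N}}$ is complete (total) in $H_\xi$, and for all $j,k$ the function $\xi\mapsto\langle g_j(\xi),g_k(\xi)\rangle_{H_\xi}$ is measurable. $\mathcal{B}(H)$ denotes the algebra of bounded linear operators on $H$. The direct integral $\int^{\oplus}_\Omega \mathcal{B}(H_\xi)\,\mathrm{d}\mu(\xi)$ is the von Neumann algebra of all decomposable operators on $\int^\oplus_\Omega H_\xi\,\mathrm{d}\mu(\xi)$, i.e. operators $S=\int^\oplus_\Omega S(\xi)\,\mathrm{d}\mu(\xi)$ with $(S(\xi))_{\xi\in\Omega}$ a measurable essentially bounded field of operators $S(\xi)\in\mathcal{B}(H_\xi)$, acting by $(Sf)(\xi)=S(\xi)f(\xi)$, with $\|S\|=\operatorname{ess\,sup}_\xi\|S(\xi)\|$; fields that agree $\mu$-almost everywhere are identified. *)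

theory Defs
  imports "HOL-Analysis.Analysis" "HOL-Algebra.Module"
begin

section \<open>Complex Hilbert spaces with explicit carrier\<close>

text \<open>
  The fibres of a measurable field vary with a point of the base space, so Hilbert spaces are
  records with a carrier: a module over the complex numbers together with an inner product
  (linear in the first argument).  The fields \<open>mult\<close> and \<open>one\<close>, which the record for modules
  inherits from the record for rings, carry no meaning.
\<close>

abbreviation complex_scalars :: "complex ring" where
  "complex_scalars \<equiv> \<lparr>carrier = UNIV, mult = (*), one = 1, zero = 0, add = (+)\<rparr>"

record 'h hilbert = "(complex, 'h) module" +
  iprod :: "'h \<Rightarrow> 'h \<Rightarrow> complex"

definition hnorm :: "'h hilbert \<Rightarrow> 'h \<Rightarrow> real" where
  "hnorm V x = sqrt (Re (iprod V x x))"

text \<open>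
  The value 0 off the carrier is needed because \<^locale>\<open>Metric_space\<close> demands symmetry and
  nonnegativity on the whole type.
\<close>

definition hdist :: "'h hilbert \<Rightarrow> 'h \<Rightarrow> 'h \<Rightarrow> real" where
  "hdist V x y =
     (if x \<in> carrier V \<and> y \<in> carrier V then hnorm V (x \<ominus>\<^bsub>V\<^esub> y) else 0)"

abbreviation htopology :: "'h hilbert \<Rightarrow> 'h topology" where
  "htopology V \<equiv> Metric_space.mtopology (carrier V) (hdist V)"

locale complex_hilbert_space = module complex_scalars V for V :: "'h hilbert" (structure) +
  assumes iprod_add_left:
      "\<lbrakk>x \<in> carrier V; y \<in> carrier V; z \<in> carrier V\<rbrakk>
       \<Longrightarrow> iprod V (x \<oplus> y) z = iprod V x z + iprod V y z"
    and iprod_smult_left: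
      "\<lbrakk>x \<in> carrier V; y \<in> carrier V\<rbrakk> \<Longrightarrow> iprod V (a \<odot> x) y = a * iprod V x y"
    and iprod_commute:
      "\<lbrakk>x \<in> carrier V; y \<in> carrier V\<rbrakk> \<Longrightarrow> iprod V y x = cnj (iprod V x y)"
    and iprod_pos: "x \<in> carrier V \<Longrightarrow> x \<noteq> \<zero> \<Longrightarrow> 0 < Re (iprod V x x)"
    and complete: "Metric_space.mcomplete (carrier V) (hdist V)"

definition lin_indep :: "'h hilbert \<Rightarrow> 'h set \<Rightarrow> bool" where
  "lin_indep V F \<longleftrightarrow>
     (\<forall>c. (\<Oplus>\<^bsub>V\<^esub>x\<in>F. c x \<odot>\<^bsub>V\<^esub> x) = \<zero>\<^bsub>V\<^esub> \<longrightarrow> (\<forall>x\<in>F. c x = 0))"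

text \<open>All infinite dimensions are identified.\<close>

definition hdim :: "'h hilbert \<Rightarrow> enat" where
  "hdim V = (SUP F \<in> {F. finite F \<and> F \<subseteq> carrier V \<and> lin_indep V F}. enat (card F))"

definition lin_span :: "'h hilbert \<Rightarrow> 'h set \<Rightarrow> 'h set" where
  "lin_span V A = (\<lambda>W. submodule W complex_scalars V) hull A"

definition total_in :: "'h hilbert \<Rightarrow> 'h set \<Rightarrow> bool" where
  "total_in V A \<longleftrightarrow> htopology V closure_of lin_span V A = carrier V"

definition bounded_ops :: "'h hilbert \<Rightarrow> ('h \<Rightarrow> 'h) set" where
  "bounded_ops V =
     {T \<in> carrier V \<rightarrow>\<^sub>E carrier V.
        (\<forall>x\<in>carrier V. \<forall>y\<in>carrier V. T (x \<oplus>\<^bsub>V\<^esub> y) = T x \<oplus>\<^bsub>V\<^esub> T y) \<and>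
        (\<forall>a. \<forall>x\<in>carrier V. T (a \<odot>\<^bsub>V\<^esub> x) = a \<odot>\<^bsub>V\<^esub> T x) \<and>
        (\<exists>C. \<forall>x\<in>carrier V. hnorm V (T x) \<le> C * hnorm V x)}"

definition op_norm :: "'h hilbert \<Rightarrow> ('h \<Rightarrow> 'h) \<Rightarrow> real" where
  "op_norm V T = (SUP x \<in> {x \<in> carrier V. hnorm V x \<le> 1}. hnorm V (T x))"

section \<open>Measurable fields of Hilbert spaces\<close>

locale measurable_hilbert_field =
  fixes M :: "'w measure" and H :: "'w \<Rightarrow> 'h hilbert" and g :: "nat \<Rightarrow> 'w \<Rightarrow> 'h"
  assumes hilbert: "\<xi> \<in> space M \<Longrightarrow> complex_hilbert_space (H \<xi>)"
    and fundamental_carrier: "\<xi> \<in> space M \<Longrightarrow> g j \<xi> \<in> carrier (H \<xi>)"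
    and fundamental_measurable:
      "(\<lambda>\<xi>. iprod (H \<xi>) (g j \<xi>) (g k \<xi>)) \<in> borel_measurable M"
    and fundamental_total: "\<xi> \<in> space M \<Longrightarrow> total_in (H \<xi>) (range (\<lambda>j. g j \<xi>))"

text \<open>
  Vector fields are only constrained on \<open>space M\<close>; their values elsewhere are irrelevant.
\<close>

definition measurable_vector_fields ::
    "'w measure \<Rightarrow> ('w \<Rightarrow> 'h hilbert) \<Rightarrow> (nat \<Rightarrow> 'w \<Rightarrow> 'h) \<Rightarrow> ('w \<Rightarrow> 'h) set" where
  "measurable_vector_fields M H g =
     {f \<in> (\<Pi> \<xi>\<in>space M. carrier (H \<xi>)).
        \<forall>j. (\<lambda>\<xi>. iprod (H \<xi>) (f \<xi>) (g j \<xi>)) \<in> borel_measurable M}"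

definition measurable_operator_fields ::
    "'w measure \<Rightarrow> ('w \<Rightarrow> 'h hilbert) \<Rightarrow> (nat \<Rightarrow> 'w \<Rightarrow> 'h) \<Rightarrow> ('w \<Rightarrow> 'h \<Rightarrow> 'h) set" where
  "measurable_operator_fields M H g =
     {S \<in> (\<Pi> \<xi>\<in>space M. bounded_ops (H \<xi>)).
        \<forall>f\<in>measurable_vector_fields M H g.
          (\<lambda>\<xi>. S \<xi> (f \<xi>)) \<in> measurable_vector_fields M H g}"

definition essentially_bounded ::
    "'w measure \<Rightarrow> ('w \<Rightarrow> 'h hilbert) \<Rightarrow> ('w \<Rightarrow> 'h \<Rightarrow> 'h) \<Rightarrow> bool" where
  "essentially_bounded M H S \<longleftrightarrow> (\<exists>C. AE \<xi> in M. op_norm (H \<xi>) (S \<xi>) \<le> C)"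

section \<open>Direct integrals\<close>

definition square_integrable_fields ::
    "'w measure \<Rightarrow> ('w \<Rightarrow> 'h hilbert) \<Rightarrow> (nat \<Rightarrow> 'w \<Rightarrow> 'h) \<Rightarrow> ('w \<Rightarrow> 'h) set" where
  "square_integrable_fields M H g =
     {f \<in> measurable_vector_fields M H g. integrable M (\<lambda>\<xi>. (hnorm (H \<xi>) (f \<xi>))\<^sup>2)}"

definition ae_rel ::
    "'w measure \<Rightarrow> ('w \<Rightarrow> 'h hilbert) \<Rightarrow> (nat \<Rightarrow> 'w \<Rightarrow> 'h) \<Rightarrow> (('w \<Rightarrow> 'h) \<times> ('w \<Rightarrow> 'h)) set" where
  "ae_rel M H g =
     {(f, h). f \<in> square_integrable_fields M H g \<and> h \<in> square_integrable_fields M H g \<and>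
              (AE \<xi> in M. f \<xi> = h \<xi>)}"

text \<open>
  The elements of the direct integral are almost-everywhere classes of square-integrable
  vector fields; all operations are defined through representatives.
\<close>

definition direct_integral ::
    "'w measure \<Rightarrow> ('w \<Rightarrow> 'h hilbert) \<Rightarrow> (nat \<Rightarrow> 'w \<Rightarrow> 'h) \<Rightarrow> ('w \<Rightarrow> 'h) set hilbert" where
  "direct_integral M H g =
     \<lparr>carrier = square_integrable_fields M H g // ae_rel M H g,
      mult = undefined,
      one = undefined,
      zero = ae_rel M H g `` {\<lambda>\<xi>. \<zero>\<^bsub>H \<xi>\<^esub>},
      add = (\<lambda>C D. \<Union>f\<in>C. \<Union>h\<in>D. ae_rel M H g `` {\<lambda>\<xi>. f \<xi> \<oplus>\<^bsub>H \<xi>\<^esub> h \<xi>}),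
      smult = (\<lambda>a C. \<Union>f\<in>C. ae_rel M H g `` {\<lambda>\<xi>. a \<odot>\<^bsub>H \<xi>\<^esub> f \<xi>}),
      iprod = (\<lambda>C D. \<integral>\<xi>. iprod (H \<xi>) ((SOME f. f \<in> C) \<xi>) ((SOME h. h \<in> D) \<xi>) \<partial>M)\<rparr>"

definition direct_integral_op ::
    "'w measure \<Rightarrow> ('w \<Rightarrow> 'h hilbert) \<Rightarrow> (nat \<Rightarrow> 'w \<Rightarrow> 'h) \<Rightarrow> ('w \<Rightarrow> 'h \<Rightarrow> 'h)
     \<Rightarrow> ('w \<Rightarrow> 'h) set \<Rightarrow> ('w \<Rightarrow> 'h) set" where
  "direct_integral_op M H g S =
     (\<lambda>C\<in>carrier (direct_integral M H g). \<Union>f\<in>C. ae_rel M H g `` {\<lambda>\<xi>. S \<xi> (f \<xi>)})"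

definition decomposable_ops ::
    "'w measure \<Rightarrow> ('w \<Rightarrow> 'h hilbert) \<Rightarrow> (nat \<Rightarrow> 'w \<Rightarrow> 'h)
     \<Rightarrow> (('w \<Rightarrow> 'h) set \<Rightarrow> ('w \<Rightarrow> 'h) set) set" where
  "decomposable_ops M H g =
     {T \<in> bounded_ops (direct_integral M H g).
        \<exists>S\<in>measurable_operator_fields M H g.
          essentially_bounded M H S \<and> T = direct_integral_op M H g S}"

definition commutative_ops :: "'h hilbert \<Rightarrow> ('h \<Rightarrow> 'h) set \<Rightarrow> bool" where
  "commutative_ops V A \<longleftrightarrow>
     (\<forall>S\<in>A. \<forall>T\<in>A. compose (carrier V) S T = compose (carrier V) T S)"

end

theory Submission
  imports Defs
begin

text \<open>
  By totality of the fundamental sequence, \<open>hdim (H \<xi>) \<ge> 2\<close> iff some Gram determinant of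
  \<open>g j \<xi>\<close> and \<open>g k \<xi>\<close> is nonzero, so the set in question is a countable union of measurable
  sets.  If it is null, any two decomposable operators act on almost every fibre as scalars and
  hence commute.  Conversely, let \<open>E\<close> be a set of finite measure on which the Gram determinant of
  \<open>u = g j\<close> and \<open>v = g k\<close> is nonzero and \<open>u\<close>, \<open>v\<close> are bounded.  The rank-one fields
  \<open>x \<mapsto> \<langle>x, u\<rangle> v\<close> and \<open>x \<mapsto> \<langle>x, v\<rangle> u\<close>, cut off to \<open>E\<close>, are decomposable, and comparing the two
  products on the field \<open>u\<close> shows that they fail to commute at every point of \<open>E\<close>.
  Commutativity therefore makes every such \<open>E\<close> null, and by \<open>\<sigma>\<close>-finiteness countably many of
  them cover the set.
\<close>

section \<open>Hilbert spaces with explicit carrier\<close>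

context complex_hilbert_space
begin

section \<open>Algebra of the inner product and the norm of a fibre\<close>

lemma smult_in_carrier [simp, intro]: "x \<in> carrier V \<Longrightarrow> a \<odot> x \<in> carrier V"
  using smult_closed[of a x] by simp

lemma minus_eq_zero_iff [simp]:
  "\<lbrakk>x \<in> carrier V; y \<in> carrier V\<rbrakk> \<Longrightarrow> x \<ominus> y = \<zero> \<longleftrightarrow> x = y"
  by (metis a_minus_def M.add.inv_closed M.minus_equality M.r_neg M.minus_minus)

lemma minus_self [simp]: "x \<in> carrier V \<Longrightarrow> x \<ominus> x = \<zero>"
  by simp

lemma iprod_zero_left [simp]: "z \<in> carrier V \<Longrightarrow> iprod V \<zero> z = 0"
  using iprod_add_left[of \<zero> \<zero> z] by simp

lemma iprod_zero_right [simp]: "z \<in> carrier V \<Longrightarrow> iprod V z \<zero> = 0"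
  using iprod_commute[of \<zero> z] by simp

lemma iprod_uminus_left:
  "\<lbrakk>x \<in> carrier V; z \<in> carrier V\<rbrakk> \<Longrightarrow> iprod V (\<ominus> x) z = - iprod V x z"
  using iprod_add_left[of "\<ominus> x" x z] by (simp add: l_neg eq_neg_iff_add_eq_0)

lemma iprod_minus_left:
  "\<lbrakk>x \<in> carrier V; y \<in> carrier V; z \<in> carrier V\<rbrakk>
   \<Longrightarrow> iprod V (x \<ominus> y) z = iprod V x z - iprod V y z"
  by (simp add: a_minus_def iprod_add_left iprod_uminus_left)

lemma iprod_add_right:
  "\<lbrakk>x \<in> carrier V; y \<in> carrier V; z \<in> carrier V\<rbrakk>
   \<Longrightarrow> iprod V z (x \<oplus> y) = iprod V z x + iprod V z y"
  by (metis a_closed complex_cnj_add iprod_add_left iprod_commute)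

lemma iprod_smult_right:
  "\<lbrakk>x \<in> carrier V; z \<in> carrier V\<rbrakk> \<Longrightarrow> iprod V z (a \<odot> x) = cnj a * iprod V z x"
  by (metis complex_cnj_mult iprod_commute iprod_smult_left smult_in_carrier)

lemma iprod_minus_right:
  "\<lbrakk>x \<in> carrier V; y \<in> carrier V; z \<in> carrier V\<rbrakk>
   \<Longrightarrow> iprod V z (x \<ominus> y) = iprod V z x - iprod V z y"
  by (metis minus_closed complex_cnj_diff iprod_minus_left iprod_commute)

lemmas iprod_simps =
  iprod_add_left iprod_minus_left iprod_smult_left
  iprod_add_right iprod_minus_right iprod_smult_right

lemma Re_iprod_self_nonneg: "x \<in> carrier V \<Longrightarrow> 0 \<le> Re (iprod V x x)"
  using iprod_pos[of x] by (cases "x = \<zero>") auto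

lemma hnorm_nonneg [simp]: "x \<in> carrier V \<Longrightarrow> 0 \<le> hnorm V x"
  by (simp add: hnorm_def Re_iprod_self_nonneg)

lemma hnorm_sq: "x \<in> carrier V \<Longrightarrow> (hnorm V x)\<^sup>2 = Re (iprod V x x)"
  by (simp add: hnorm_def Re_iprod_self_nonneg)

lemma iprod_self: "x \<in> carrier V \<Longrightarrow> iprod V x x = of_real ((hnorm V x)\<^sup>2)"
  using iprod_commute[of x x] by (simp add: hnorm_sq complex_eq_iff)

lemma iprod_self_eq_0_iff: "x \<in> carrier V \<Longrightarrow> iprod V x x = 0 \<longleftrightarrow> x = \<zero>"
  using iprod_pos[of x] by force

lemma hnorm_eq_0_iff: "x \<in> carrier V \<Longrightarrow> hnorm V x = 0 \<longleftrightarrow> x = \<zero>"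
  using iprod_self[of x] iprod_self_eq_0_iff[of x] by simp

lemma hnorm_zero [simp]: "hnorm V \<zero> = 0"
  by (simp add: hnorm_eq_0_iff)

text \<open>The difference \<open>x \<ominus> y\<close> is orthogonal to itself. Below this turns
  identities between vectors into identities between complex numbers, in place of calculations with
  the module axioms.\<close>

lemma eq_if_iprod_eq:
  assumes "x \<in> carrier V" "y \<in> carrier V"
    and "\<And>z. z \<in> carrier V \<Longrightarrow> iprod V x z = iprod V y z"
  shows "x = y"
proof -
  have "iprod V (x \<ominus> y) (x \<ominus> y) = 0"
    using assms by (simp add: iprod_minus_left)
  then show ?thesis
    using assms by (simp add: iprod_self_eq_0_iff)
qed

lemma hnorm_smult: "x \<in> carrier V \<Longrightarrow> hnorm V (a \<odot> x) = cmod a * hnorm V x"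
proof -
  assume x: "x \<in> carrier V"
  have "iprod V (a \<odot> x) (a \<odot> x) = (a * cnj a) * iprod V x x"
    using x by (simp add: iprod_simps)
  also have "\<dots> = of_real ((cmod a * hnorm V x)\<^sup>2)"
    using x by (simp add: iprod_self complex_norm_square[symmetric] power_mult_distrib)
  finally have "(hnorm V (a \<odot> x))\<^sup>2 = (cmod a * hnorm V x)\<^sup>2"
    using x by (simp add: hnorm_sq)
  then show ?thesis
    using x by (simp add: power2_eq_iff_nonneg)
qed

text \<open>The vector \<open>z\<close> is the component of \<open>x\<close> orthogonal to
  \<open>y\<close>, scaled by \<open>iprod V y y\<close> so that no division occurs and
  \<open>y = \<zero>\<close> is covered. The bracket on the right is the Gram determinant of
  \<open>x\<close> and \<open>y\<close>.\<close>

lemma iprod_gram_residual: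
  assumes "x \<in> carrier V" "y \<in> carrier V"
  defines "z \<equiv> iprod V y y \<odot> x \<ominus> iprod V x y \<odot> y"
  shows "iprod V z z =
    iprod V y y * (iprod V y y * iprod V x x - iprod V x y * iprod V y x)"
proof -
  have "cnj (iprod V y y) = iprod V y y" "cnj (iprod V x y) = iprod V y x"
    using assms iprod_commute by metis+
  then show ?thesis
    using assms by (simp add: iprod_simps algebra_simps)
qed

text \<open>For nonzero \<open>y\<close> the squared norm of the residual in
  \<open>iprod_gram_residual\<close> is nonnegative, and the positive factor
  \<open>(hnorm V y)\<^sup>2\<close> can be divided out.\<close>

lemma cauchy_schwarz:
  assumes "x \<in> carrier V" "y \<in> carrier V"
  shows "cmod (iprod V x y) \<le> hnorm V x * hnorm V y"
proof (cases "y = \<zero>")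
  case False
  have pos: "0 < (hnorm V y)\<^sup>2"
    using False assms by (simp add: hnorm_eq_0_iff)
  have xy: "iprod V x y * iprod V y x = of_real ((cmod (iprod V x y))\<^sup>2)"
    using assms iprod_commute[of x y] by (metis complex_norm_square)
  have "iprod V y y * (iprod V y y * iprod V x x - iprod V x y * iprod V y x)
      = of_real ((hnorm V y)\<^sup>2 * ((hnorm V y)\<^sup>2 * (hnorm V x)\<^sup>2 - (cmod (iprod V x y))\<^sup>2))"
    using assms by (simp add: iprod_self xy)
  then have "0 \<le> (hnorm V y)\<^sup>2 * ((hnorm V y)\<^sup>2 * (hnorm V x)\<^sup>2 - (cmod (iprod V x y))\<^sup>2)"
    using assms iprod_gram_residual[of x y]
      Re_iprod_self_nonneg[of "iprod V y y \<odot> x \<ominus> iprod V x y \<odot> y"]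
    by (metis Re_complex_of_real minus_closed smult_in_carrier)
  then have "(cmod (iprod V x y))\<^sup>2 \<le> (hnorm V x * hnorm V y)\<^sup>2"
    using pos by (simp add: zero_le_mult_iff power_mult_distrib mult.commute)
  then show ?thesis
    using assms by (simp add: power2_le_iff_abs_le)
qed (use assms in simp)

lemma hnorm_add_sq:
  "\<lbrakk>x \<in> carrier V; y \<in> carrier V\<rbrakk>
   \<Longrightarrow> (hnorm V (x \<oplus> y))\<^sup>2 = (hnorm V x)\<^sup>2 + 2 * Re (iprod V x y) + (hnorm V y)\<^sup>2"
  using iprod_commute[of x y] by (simp add: hnorm_sq iprod_simps)

lemma hnorm_minus_sq:
  "\<lbrakk>x \<in> carrier V; y \<in> carrier V\<rbrakk>
   \<Longrightarrow> (hnorm V (x \<ominus> y))\<^sup>2 = (hnorm V x)\<^sup>2 - 2 * Re (iprod V x y) + (hnorm V y)\<^sup>2"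
  using iprod_commute[of x y] by (simp add: hnorm_sq iprod_simps)

lemma hnorm_triangle:
  assumes "x \<in> carrier V" "y \<in> carrier V"
  shows "hnorm V (x \<oplus> y) \<le> hnorm V x + hnorm V y"
proof -
  have "Re (iprod V x y) \<le> hnorm V x * hnorm V y"
    using cauchy_schwarz[OF assms] complex_Re_le_cmod order_trans by blast
  then have "(hnorm V (x \<oplus> y))\<^sup>2 \<le> (hnorm V x + hnorm V y)\<^sup>2"
    using assms by (simp add: hnorm_add_sq power2_sum)
  then show ?thesis
    using assms by (simp add: power2_le_iff_abs_le)
qed

text \<open>The parallelogram law with the squared norm of \<open>x \<ominus> y\<close> discarded.
  It provides the integrable majorant for sums of square-integrable fields.\<close>

lemma hnorm_add_sq_le:
  assumes "x \<in> carrier V" "y \<in> carrier V"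
  shows "(hnorm V (x \<oplus> y))\<^sup>2 \<le> 2 * (hnorm V x)\<^sup>2 + 2 * (hnorm V y)\<^sup>2"
  using assms hnorm_add_sq[OF assms] hnorm_minus_sq[OF assms]
    zero_le_power2[of "hnorm V (x \<ominus> y)"] by linarith

lemma hnorm_minus_commute:
  assumes "x \<in> carrier V" "y \<in> carrier V"
  shows "hnorm V (x \<ominus> y) = hnorm V (y \<ominus> x)"
  using assms iprod_commute[of x y] by (simp add: hnorm_def iprod_simps)

lemma hnorm_minus_triangle:
  assumes "x \<in> carrier V" "y \<in> carrier V" "z \<in> carrier V"
  shows "hnorm V (x \<ominus> z) \<le> hnorm V (x \<ominus> y) + hnorm V (y \<ominus> z)"
proof -
  have "x \<ominus> z = (x \<ominus> y) \<oplus> (y \<ominus> z)"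
    using assms by (intro eq_if_iprod_eq) (simp_all add: iprod_simps)
  then show ?thesis
    using assms hnorm_triangle[of "x \<ominus> y" "y \<ominus> z"] by simp
qed

lemma Metric_space_hdist: "Metric_space (carrier V) (hdist V)"
proof
  fix x y
  show "0 \<le> hdist V x y"
    by (simp add: hdist_def)
  show "hdist V x y = hdist V y x"
    by (simp add: hdist_def hnorm_minus_commute)
  show "hdist V x y = 0 \<longleftrightarrow> x = y" if "x \<in> carrier V" "y \<in> carrier V"
    using that by (simp add: hdist_def hnorm_eq_0_iff)
next
  fix x y z
  show "hdist V x z \<le> hdist V x y + hdist V y z"
    if "x \<in> carrier V" "y \<in> carrier V" "z \<in> carrier V"
    using that by (simp add: hdist_def hnorm_minus_triangle)
qed

section \<open>Approximation from a total set\<close>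

lemma total_in_approx:
  assumes "total_in V A" "x \<in> carrier V" "0 < e"
  shows "\<exists>y\<in>lin_span V A. y \<in> carrier V \<and> hnorm V (x \<ominus> y) < e"
proof -
  interpret Metric_space "carrier V" "hdist V" by (rule Metric_space_hdist)
  have "x \<in> mtopology closure_of lin_span V A"
    using assms by (simp add: total_in_def)
  then show ?thesis
    using assms by (fastforce simp: metric_closure_of in_mball hdist_def)
qed

text \<open>The span is the least submodule containing \<open>A\<close>, so it lies in every such
  \<open>W\<close>. In applications \<open>W\<close> consists of the vectors with some property
  stable under linear combinations.\<close>

lemma total_in_induct:
  assumes "total_in V A" "submodule W complex_scalars V" "A \<subseteq> W" "x \<in> carrier V" "0 < e"
  shows "\<exists>y\<in>W. y \<in> carrier V \<and> hnorm V (x \<ominus> y) < e"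
proof -
  have "lin_span V A \<subseteq> W"
    unfolding lin_span_def using assms by (intro hull_minimal)
  then show ?thesis
    using total_in_approx[OF assms(1,4,5)] by blast
qed

text \<open>Negation is scaling by -1, so closure under inverses follows from closure under
  scalars.\<close>

lemma submoduleI_smult:
  assumes "W \<subseteq> carrier V" "\<zero> \<in> W"
    and "\<And>x y. \<lbrakk>x \<in> W; y \<in> W\<rbrakk> \<Longrightarrow> x \<oplus> y \<in> W"
    and "\<And>a x. x \<in> W \<Longrightarrow> a \<odot> x \<in> W"
  shows "submodule W complex_scalars V"
proof -
  have "\<ominus> x \<in> W" if "x \<in> W" for x
  proof -
    have "\<ominus> x = (-1) \<odot> x"
      using that assms(1) by (intro eq_if_iprod_eq) (auto simp: iprod_uminus_left iprod_simps)
    then show ?thesis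
      using assms(4)[OF that] by simp
  qed
  then show ?thesis
    using assms by (intro module.module_incl_imp_submodule submoduleI) (auto simp: module_axioms)
qed

text \<open>The vectors orthogonal to \<open>z\<close> form a submodule containing \<open>A\<close>,
  so one of them comes closer to a nonzero \<open>z\<close> than \<open>hnorm V z\<close>. By
  Pythagoras no vector orthogonal to \<open>z\<close> does.\<close>

lemma eq_zero_if_orthogonal_total:
  assumes "total_in V A" "A \<subseteq> carrier V" "z \<in> carrier V"
    and "\<And>y. y \<in> A \<Longrightarrow> iprod V z y = 0"
  shows "z = \<zero>"
proof (rule ccontr)
  assume "z \<noteq> \<zero>"
  then have pos: "0 < hnorm V z"
    using assms(3) hnorm_eq_0_iff[of z] hnorm_nonneg[of z] by linarith
  let ?W = "{y \<in> carrier V. iprod V z y = 0}"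
  have "submodule ?W complex_scalars V"
    using assms(3) by (intro submoduleI_smult) (auto simp: iprod_simps)
  then obtain y where y: "y \<in> carrier V" "iprod V z y = 0" "hnorm V (z \<ominus> y) < hnorm V z"
    using total_in_induct[OF assms(1) _ _ assms(3) pos, of ?W] assms by blast
  have "(hnorm V (z \<ominus> y))\<^sup>2 \<ge> (hnorm V z)\<^sup>2"
    using y assms(3) by (simp add: hnorm_minus_sq)
  then show False
    using y assms(3) by (simp add: power2_le_iff_abs_le)
qed

end

section \<open>Dimension and rational combinations\<close>

lemma rational_complex_dense:
  assumes "0 < e"
  shows "\<exists>a b. cmod (z - Complex (of_rat a) (of_rat b)) < e"
proof -
  obtain a where a: "Re z < of_rat a" "of_rat a < Re z + e / 2"
    using of_rat_dense[of "Re z" "Re z + e / 2"] assms by auto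
  obtain b where b: "Im z < of_rat b" "of_rat b < Im z + e / 2"
    using of_rat_dense[of "Im z" "Im z + e / 2"] assms by auto
  have "cmod (z - Complex (of_rat a) (of_rat b)) \<le> \<bar>Re z - of_rat a\<bar> + \<bar>Im z - of_rat b\<bar>"
    using cmod_le[of "z - Complex (of_rat a) (of_rat b)"] by simp
  also have "\<dots> < e"
    using a b by linarith
  finally show ?thesis
    by blast
qed

text \<open>A list entry carries the real and imaginary part of a coefficient and an index. There
  are only countably many such lists, and since indices may repeat, combinations are added by
  appending lists.\<close>

primrec rat_comb :: "'h hilbert \<Rightarrow> (nat \<Rightarrow> 'h) \<Rightarrow> (rat \<times> rat \<times> nat) list \<Rightarrow> 'h" where
  "rat_comb V G [] = \<zero>\<^bsub>V\<^esub>"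
| "rat_comb V G (p # ps) =
     (case p of (a, b, i) \<Rightarrow> Complex (of_rat a) (of_rat b) \<odot>\<^bsub>V\<^esub> G i \<oplus>\<^bsub>V\<^esub> rat_comb V G ps)"

section \<open>Dimension at least two, expressed by Gram determinants\<close>

context complex_hilbert_space
begin

text \<open>If every finite independent set had at most one element, 1 would bound the supremum.
  Hence the supremum reaches 2 only through a member that does, also when \<open>hdim V\<close> is
  infinite.\<close>

lemma two_le_hdim_iff:
  "2 \<le> hdim V \<longleftrightarrow> (\<exists>F. finite F \<and> F \<subseteq> carrier V \<and> lin_indep V F \<and> 2 \<le> card F)"
proof
  assume *: "2 \<le> hdim V"
  show "\<exists>F. finite F \<and> F \<subseteq> carrier V \<and> lin_indep V F \<and> 2 \<le> card F"
  proof (rule ccontr)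
    assume "\<not> ?thesis"
    then have "hdim V \<le> enat 1"
      unfolding hdim_def by (intro SUP_least) (force simp: not_le)
    with * have "(2::enat) \<le> enat 1"
      by (rule order_trans)
    then show False
      by (simp add: numeral_eq_enat)
  qed
next
  assume "\<exists>F. finite F \<and> F \<subseteq> carrier V \<and> lin_indep V F \<and> 2 \<le> card F"
  then obtain F where F: "finite F" "F \<subseteq> carrier V" "lin_indep V F" "2 \<le> card F"
    by blast
  then have "enat (card F) \<le> hdim V"
    unfolding hdim_def by (intro SUP_upper) simp
  moreover have "2 \<le> enat (card F)"
    using F(4) by (simp add: numeral_eq_enat)
  ultimately show "2 \<le> hdim V"
    by (rule order_trans[rotated])
qed

text \<open>Coefficients on \<open>E\<close> are extended by zero to \<open>F\<close>, which leaves
  the sum unchanged.\<close>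

lemma lin_indep_subset:
  assumes F: "finite F" "F \<subseteq> carrier V" "lin_indep V F" and "E \<subseteq> F"
  shows "lin_indep V E"
  unfolding lin_indep_def
proof (intro allI impI)
  fix c
  assume 0: "(\<Oplus>x\<in>E. c x \<odot> x) = \<zero>"
  let ?c = "\<lambda>x. if x \<in> E then c x else 0"
  have "(\<Oplus>x\<in>F. ?c x \<odot> x) = (\<Oplus>x\<in>E. c x \<odot> x)"
    using assms smult_l_null
    by (intro M.add.finprod_mono_neutral_cong_right) (auto simp: subset_iff)
  then have "\<forall>x\<in>F. ?c x = 0"
    using 0 F(3)[unfolded lin_indep_def, rule_format, of ?c] by simp
  then show "\<forall>x\<in>E. c x = 0"
    using \<open>E \<subseteq> F\<close> by (metis subsetD)
qed

lemma finsum_pair: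
  "\<lbrakk>x \<in> carrier V; y \<in> carrier V; x \<noteq> y\<rbrakk> \<Longrightarrow> (\<Oplus>z\<in>{x, y}. c z \<odot> z) = c x \<odot> x \<oplus> c y \<odot> y"
  by simp

text \<open>Distinctness matters: a coefficient function on the set \<open>{x, y}\<close> amounts to
  a pair of scalars only if the set does not collapse.\<close>

lemma lin_indep_pair_iff:
  assumes "x \<in> carrier V" "y \<in> carrier V" "x \<noteq> y"
  shows "lin_indep V {x, y} \<longleftrightarrow> (\<forall>a b. a \<odot> x \<oplus> b \<odot> y = \<zero> \<longrightarrow> a = 0 \<and> b = 0)"
proof
  assume *: "lin_indep V {x, y}"
  show "\<forall>a b. a \<odot> x \<oplus> b \<odot> y = \<zero> \<longrightarrow> a = 0 \<and> b = 0"
  proof (intro allI impI)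
    fix a b
    assume "a \<odot> x \<oplus> b \<odot> y = \<zero>"
    then have "(\<Oplus>z\<in>{x, y}. (if z = x then a else b) \<odot> z) = \<zero>"
      using finsum_pair[OF assms] assms(3) by simp
    then have "\<forall>z\<in>{x, y}. (if z = x then a else b) = 0"
      using *[unfolded lin_indep_def, rule_format, of "\<lambda>z. if z = x then a else b"] by blast
    then show "a = 0 \<and> b = 0"
      using assms(3) by auto
  qed
next
  assume "\<forall>a b. a \<odot> x \<oplus> b \<odot> y = \<zero> \<longrightarrow> a = 0 \<and> b = 0"
  then show "lin_indep V {x, y}"
    unfolding lin_indep_def finsum_pair[OF assms] by blast
qed

lemma two_le_hdim_iff_pair:
  "2 \<le> hdim V \<longleftrightarrow> (\<exists>x\<in>carrier V. \<exists>y\<in>carrier V. x \<noteq> y \<and> lin_indep V {x, y})"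
proof
  assume "2 \<le> hdim V"
  then obtain F where F: "finite F" "F \<subseteq> carrier V" "lin_indep V F" "2 \<le> card F"
    by (auto simp: two_le_hdim_iff)
  then obtain E where "E \<subseteq> F" "card E = 2"
    by (meson obtain_subset_with_card_n)
  then obtain x y where "E = {x, y}" "x \<noteq> y"
    by (auto simp: card_2_iff)
  then show "\<exists>x\<in>carrier V. \<exists>y\<in>carrier V. x \<noteq> y \<and> lin_indep V {x, y}"
    using lin_indep_subset[OF F(1-3) \<open>E \<subseteq> F\<close>] \<open>E \<subseteq> F\<close> F(2) by blast
next
  assume "\<exists>x\<in>carrier V. \<exists>y\<in>carrier V. x \<noteq> y \<and> lin_indep V {x, y}"
  then obtain x y where "x \<in> carrier V" "y \<in> carrier V" "x \<noteq> y" "lin_indep V {x, y}"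
    by blast
  then show "2 \<le> hdim V"
    unfolding two_le_hdim_iff by (intro exI[of _ "{x, y}"]) simp
qed

text \<open>Some nontrivial combination of \<open>x\<close> and \<open>y\<close> vanishes. Its
  coefficient at \<open>y\<close> is nonzero because \<open>x\<close> is, so it can be solved for
  \<open>y\<close>.\<close>

lemma collinear_if_hdim_less_2:
  assumes "\<not> 2 \<le> hdim V" "x \<in> carrier V" "y \<in> carrier V" "x \<noteq> \<zero>"
  shows "\<exists>a. y = a \<odot> x"
proof (cases "x = y")
  case True
  then have "y = 1 \<odot> x"
    using assms by (intro eq_if_iprod_eq) (simp_all add: iprod_simps)
  then show ?thesis ..
next
  case False
  then obtain a b where ab: "a \<odot> x \<oplus> b \<odot> y = \<zero>" "a \<noteq> 0 \<or> b \<noteq> 0"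
    using assms lin_indep_pair_iff[of x y] two_le_hdim_iff_pair by blast
  have eq: "a * iprod V x z + b * iprod V y z = 0" if "z \<in> carrier V" for z
    using arg_cong[OF ab(1), of "\<lambda>w. iprod V w z"] assms that by (simp add: iprod_simps)
  have "b \<noteq> 0"
    using eq[of x] ab(2) assms by (auto simp: iprod_self_eq_0_iff)
  then have "y = (- a / b) \<odot> x"
    using assms eq
    by (intro eq_if_iprod_eq) (simp_all add: iprod_simps field_simps add_eq_0_iff)
  then show ?thesis ..
qed

text \<open>Cramer's rule: pairing a vanishing combination with \<open>x\<close> and with
  \<open>y\<close> gives a homogeneous 2 by 2 system whose determinant is the Gram
  determinant.\<close>

lemma lin_indep_if_gram_nonzero:
  assumes "x \<in> carrier V" "y \<in> carrier V"
    and "iprod V x x * iprod V y y \<noteq> iprod V x y * iprod V y x"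
  shows "x \<noteq> y" "lin_indep V {x, y}"
proof -
  show "x \<noteq> y"
    using assms(3) by auto
  have "a = 0 \<and> b = 0" if "a \<odot> x \<oplus> b \<odot> y = \<zero>" for a b
  proof -
    let ?D = "iprod V x x * iprod V y y - iprod V x y * iprod V y x"
    have eq: "a * iprod V x z + b * iprod V y z = 0" if "z \<in> carrier V" for z
      using arg_cong[OF \<open>a \<odot> x \<oplus> b \<odot> y = \<zero>\<close>, of "\<lambda>w. iprod V w z"] assms(1,2) that
      by (simp add: iprod_simps)
    have "a * ?D = (a * iprod V x x + b * iprod V y x) * iprod V y y
        - (a * iprod V x y + b * iprod V y y) * iprod V y x"
      by (simp add: algebra_simps)
    then have "a * ?D = 0"
      by (simp only: eq assms mult_zero_left diff_self)
    moreover have "b * ?D = (a * iprod V x y + b * iprod V y y) * iprod V x x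
        - (a * iprod V x x + b * iprod V y x) * iprod V x y"
      by (simp add: algebra_simps)
    then have "b * ?D = 0"
      by (simp only: eq assms mult_zero_left diff_self)
    ultimately show ?thesis
      using assms(3) by simp
  qed
  then show "lin_indep V {x, y}"
    using lin_indep_pair_iff[OF assms(1,2) \<open>x \<noteq> y\<close>] by blast
qed

text \<open>If all Gram determinants over \<open>A\<close> vanish, any nonzero \<open>u\<close> in
  \<open>A\<close> spans the whole space and no independent pair is left. The criterion involves
  only inner products of members of \<open>A\<close>, which is what measurability needs.\<close>

lemma two_le_hdim_iff_gram:
  assumes "total_in V A" "A \<subseteq> carrier V"
  shows "2 \<le> hdim V \<longleftrightarrow>
    (\<exists>x\<in>A. \<exists>y\<in>A. iprod V x x * iprod V y y \<noteq> iprod V x y * iprod V y x)"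
proof
  assume "\<exists>x\<in>A. \<exists>y\<in>A. iprod V x x * iprod V y y \<noteq> iprod V x y * iprod V y x"
  then show "2 \<le> hdim V"
    using lin_indep_if_gram_nonzero assms(2) unfolding two_le_hdim_iff_pair by blast
next
  assume "2 \<le> hdim V"
  then obtain x y where xy: "x \<in> carrier V" "y \<in> carrier V" "x \<noteq> y" "lin_indep V {x, y}"
    unfolding two_le_hdim_iff_pair by blast
  show "\<exists>x\<in>A. \<exists>y\<in>A. iprod V x x * iprod V y y \<noteq> iprod V x y * iprod V y x"
  proof (rule ccontr)
    assume "\<not> ?thesis"
    then have gram: "iprod V u u * iprod V w w = iprod V u w * iprod V w u"
      if "u \<in> A" "w \<in> A" for u w
      using that by blast
    \<comment> \<open>Division-free form of the fact that every vector is its own projection onto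
      \<open>u\<close>. For members \<open>w\<close> of \<open>A\<close> the vanishing Gram
      determinant kills the residual; arbitrary \<open>z\<close> are then tested against
      \<open>A\<close>.\<close>
    have line: "iprod V u u \<odot> z = iprod V z u \<odot> u" if u: "u \<in> A" and z: "z \<in> carrier V" for u z
    proof -
      have uc: "u \<in> carrier V"
        using u assms(2) by blast
      have "iprod V u u \<odot> z \<ominus> iprod V z u \<odot> u = \<zero>"
      proof (rule eq_zero_if_orthogonal_total[OF assms])
        fix w
        assume w: "w \<in> A"
        then have wc: "w \<in> carrier V"
          using assms(2) by blast
        have "iprod V u u \<odot> w \<ominus> iprod V w u \<odot> u = \<zero>"
          using iprod_gram_residual[OF wc uc] gram[OF u w] uc wc
          by (simp add: mult.commute iprod_self_eq_0_iff flip: minus_eq_zero_iff)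
        then have "iprod V z (iprod V u u \<odot> w) = iprod V z (iprod V w u \<odot> u)"
          using uc wc by simp
        then have "iprod V u u * iprod V z w = iprod V u w * iprod V z u"
          using uc wc z iprod_commute[OF uc uc] iprod_commute[OF uc wc]
          by (simp add: iprod_simps)
        then show "iprod V (iprod V u u \<odot> z \<ominus> iprod V z u \<odot> u) w = 0"
          using uc wc z by (simp add: iprod_simps mult.commute)
      qed (use uc z in simp)
      then show ?thesis
        using uc z by simp
    qed
    show False
    proof (cases "A \<subseteq> {\<zero>}")
      \<comment> \<open>A total set without nonzero vectors forces the space to be zero, leaving no
        room for the distinct \<open>x\<close> and \<open>y\<close>.\<close>
      case True
      then have "z = \<zero>" if "z \<in> carrier V" for z
        using eq_zero_if_orthogonal_total[OF assms that] iprod_zero_right[OF that] by blast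
      then show False
        using xy by metis
    next
      case False
      then obtain u where u: "u \<in> A" "u \<in> carrier V" "u \<noteq> \<zero>"
        using assms(2) by blast
      have inner: "iprod V u u * iprod V z w = iprod V z u * iprod V u w"
        if "z \<in> carrier V" "w \<in> carrier V" for z w
        using arg_cong[OF line[OF u(1) that(1)], of "\<lambda>v. iprod V v w"] that u
        by (simp add: iprod_simps)
      \<comment> \<open>Both \<open>x\<close> and \<open>y\<close> are multiples of
        \<open>u\<close>, in the proportion of \<open>iprod V x u\<close> to
        \<open>iprod V y u\<close>; cross-multiplication yields the dependency.\<close>
      have "iprod V y u \<odot> x \<oplus> (- iprod V x u) \<odot> y = \<zero>"
      proof (intro eq_if_iprod_eq)
        fix z
        assume z: "z \<in> carrier V"
        have "iprod V u u * (iprod V y u * iprod V x z - iprod V x u * iprod V y z)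
          = iprod V y u * (iprod V u u * iprod V x z) - iprod V x u * (iprod V u u * iprod V y z)"
          by (simp add: algebra_simps)
        also have "\<dots> = 0"
          by (simp only: inner xy z) (simp add: algebra_simps)
        finally show "iprod V (iprod V y u \<odot> x \<oplus> (- iprod V x u) \<odot> y) z = iprod V \<zero> z"
          using xy z u by (simp add: iprod_simps iprod_self_eq_0_iff)
      qed (use xy in simp_all)
      \<comment> \<open>Independence makes \<open>x\<close> and \<open>y\<close> orthogonal to
        \<open>u\<close>. Being multiples of \<open>u\<close>, both vanish and hence
        coincide.\<close>
      then have "iprod V y u = 0 \<and> - iprod V x u = 0"
        using xy lin_indep_pair_iff by blast
      then have "iprod V x u = 0" "iprod V y u = 0"
        by simp_all
      then have "iprod V x w = 0" "iprod V y w = 0" if "w \<in> carrier V" for w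
        using inner[OF xy(1) that] inner[OF xy(2) that] u by (simp_all add: iprod_self_eq_0_iff)
      then have "x = y"
        using xy by (intro eq_if_iprod_eq) simp_all
      then show False
        using xy by simp
    qed
  qed
qed

section \<open>Density of the rational combinations of a total sequence\<close>

lemma rat_comb_closed [simp]: "range G \<subseteq> carrier V \<Longrightarrow> rat_comb V G ps \<in> carrier V"
  by (induction ps) auto

lemma rat_comb_append:
  "range G \<subseteq> carrier V \<Longrightarrow> rat_comb V G (ps @ qs) = rat_comb V G ps \<oplus> rat_comb V G qs"
  by (induction ps) (auto simp: M.a_assoc image_subset_iff)

text \<open>Gaussian rationals are closed under multiplication, so the scalar can be absorbed into
  every coefficient of the list.\<close>

lemma rat_comb_smult:
  assumes "range G \<subseteq> carrier V"
  shows "\<exists>qs. rat_comb V G qs = Complex (of_rat a) (of_rat b) \<odot> rat_comb V G ps"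
proof (induction ps)
  case Nil
  then show ?case
    by (intro exI[of _ "[]"]) (simp add: eq_if_iprod_eq iprod_simps)
next
  case (Cons p ps)
  obtain c d i where p: "p = (c, d, i)"
    by (cases p)
  from Cons obtain qs where "rat_comb V G qs = Complex (of_rat a) (of_rat b) \<odot> rat_comb V G ps" ..
  moreover have "Complex (of_rat (a * c - b * d)) (of_rat (a * d + b * c))
      = Complex (of_rat a) (of_rat b) * Complex (of_rat c) (of_rat d)"
    by (simp add: complex_eq_iff of_rat_mult of_rat_add of_rat_diff)
  ultimately have "rat_comb V G ((a * c - b * d, a * d + b * c, i) # qs)
      = Complex (of_rat a) (of_rat b) \<odot> rat_comb V G (p # ps)"
    using assms unfolding p
    by (intro eq_if_iprod_eq) (auto simp: iprod_simps image_subset_iff algebra_simps)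
  then show ?case ..
qed

text \<open>The closure \<open>?K\<close> of the rational combinations is a submodule over all
  complex scalars, because these are limits of Gaussian rationals. Totality brings \<open>x\<close>
  within \<open>e / 2\<close> of \<open>?K\<close>, and a rational combination comes within another
  \<open>e / 2\<close>.\<close>

lemma rat_comb_dense:
  assumes "total_in V (range G)" "range G \<subseteq> carrier V" "x \<in> carrier V" "0 < e"
  shows "\<exists>ps. hnorm V (x \<ominus> rat_comb V G ps) < e"
proof -
  let ?K = "{x \<in> carrier V. \<forall>e>0. \<exists>ps. hnorm V (x \<ominus> rat_comb V G ps) < e}"
  note [simp] = rat_comb_closed[OF assms(2)]
  have "submodule ?K complex_scalars V"
  proof (rule submoduleI_smult, goal_cases)
    case 2
    have "\<exists>ps. hnorm V (\<zero> \<ominus> rat_comb V G ps) < e" if "0 < e" for e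
      using that by (intro exI[of _ "[]"]) simp
    then show ?case
      by simp
  next
    case (3 x y)
    have "\<exists>ps. hnorm V (x \<oplus> y \<ominus> rat_comb V G ps) < e" if e: "0 < e" for e
    proof -
      obtain ps where ps: "hnorm V (x \<ominus> rat_comb V G ps) < e / 2"
        using 3 e half_gt_zero by blast
      obtain qs where qs: "hnorm V (y \<ominus> rat_comb V G qs) < e / 2"
        using 3 e half_gt_zero by blast
      have "x \<oplus> y \<ominus> rat_comb V G (ps @ qs)
          = (x \<ominus> rat_comb V G ps) \<oplus> (y \<ominus> rat_comb V G qs)"
        using 3 assms(2) by (intro eq_if_iprod_eq) (simp_all add: rat_comb_append iprod_simps)
      also have "hnorm V \<dots> < e"
        using hnorm_triangle[of "x \<ominus> rat_comb V G ps" "y \<ominus> rat_comb V G qs"] ps qs 3 by simp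
      finally show ?thesis ..
    qed
    then show ?case
      using 3 by simp
  next
    case (4 c x)
    have "\<exists>ps. hnorm V (c \<odot> x \<ominus> rat_comb V G ps) < e" if e: "0 < e" for e
    proof -
      let ?n = "hnorm V x"
      have x: "x \<in> carrier V" "0 \<le> ?n"
        using 4 by simp_all
      \<comment> \<open>The error is split into \<open>(c - q) \<odot> x\<close> and
        \<open>q\<close> times the error in approximating \<open>x\<close>, with
        \<open>e / 2\<close> for each. Adding 1 in \<open>?n + 1\<close> and
        \<open>cmod q + 1\<close> keeps the denominators positive when \<open>x\<close> or
        \<open>q\<close> is zero.\<close>
      obtain a b where ab: "cmod (c - Complex (of_rat a) (of_rat b)) < e / 2 / (?n + 1)"
        using rational_complex_dense[of "e / 2 / (?n + 1)" c] e x by auto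
      define q where "q = Complex (of_rat a) (of_rat b)"
      have q1: "0 < cmod q + 1"
        by (simp add: add_nonneg_pos)
      then have "0 < e / 2 / (cmod q + 1)"
        using e by simp
      then obtain ps where ps: "hnorm V (x \<ominus> rat_comb V G ps) < e / 2 / (cmod q + 1)"
        using 4 by blast
      obtain qs where qs: "rat_comb V G qs = q \<odot> rat_comb V G ps"
        using rat_comb_smult[OF assms(2)] unfolding q_def by blast
      have "cmod (c - q) * ?n \<le> cmod (c - q) * (?n + 1)"
        by (simp add: mult_left_mono)
      also have "\<dots> < e / 2"
        using ab x unfolding q_def by (simp add: pos_less_divide_eq algebra_simps)
      finally have 1: "cmod (c - q) * ?n < e / 2" .
      have "cmod q * hnorm V (x \<ominus> rat_comb V G ps)
          \<le> (cmod q + 1) * hnorm V (x \<ominus> rat_comb V G ps)"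
        using x by (simp add: mult_right_mono)
      also have "\<dots> < e / 2"
        using ps[unfolded pos_less_divide_eq[OF q1]] by (simp only: mult.commute)
      finally have 2: "cmod q * hnorm V (x \<ominus> rat_comb V G ps) < e / 2" .
      have "c \<odot> x \<ominus> rat_comb V G qs = (c - q) \<odot> x \<oplus> q \<odot> (x \<ominus> rat_comb V G ps)"
        unfolding qs using x by (intro eq_if_iprod_eq) (simp_all add: iprod_simps algebra_simps)
      also have "hnorm V \<dots> < e"
        using hnorm_triangle[of "(c - q) \<odot> x" "q \<odot> (x \<ominus> rat_comb V G ps)"] 1 2 x
        by (simp add: hnorm_smult)
      finally show ?thesis ..
    qed
    then show ?case
      using 4 by simp
  qed auto
  moreover have "range G \<subseteq> ?K"
  proof -
    have "G i \<in> ?K" for i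
    proof -
      have Gi: "G i \<in> carrier V"
        using assms(2) by blast
      have "Complex 1 0 = 1"
        by (simp add: complex_eq_iff)
      then have "Complex 1 0 \<odot> G i = G i"
        using Gi by (intro eq_if_iprod_eq) (simp_all add: iprod_simps)
      then have "hnorm V (G i \<ominus> rat_comb V G [(1, 0, i)]) = 0"
        using Gi by simp
      then have "\<exists>ps. hnorm V (G i \<ominus> rat_comb V G ps) < e" if "0 < e" for e
        using that by (intro exI[of _ "[(1, 0, i)]"]) simp
      then show ?thesis
        using Gi by simp
    qed
    then show ?thesis
      by blast
  qed
  ultimately obtain y where y: "y \<in> ?K" "hnorm V (x \<ominus> y) < e / 2"
    using total_in_induct[OF assms(1) _ _ assms(3), of ?K "e / 2"] assms(4) half_gt_zero by blast
  then obtain ps where "hnorm V (y \<ominus> rat_comb V G ps) < e / 2"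
    using assms(4) half_gt_zero by blast
  then have "hnorm V (x \<ominus> rat_comb V G ps) < e"
    using y hnorm_minus_triangle[of x y "rat_comb V G ps"] assms(3) by simp
  then show ?thesis ..
qed

end

section \<open>Measurable fields\<close>

context measurable_hilbert_field
begin

section \<open>Closure properties of measurable vector fields\<close>

lemma iprod_measurable_fundamental:
  "f \<in> measurable_vector_fields M H g \<Longrightarrow>
   (\<lambda>\<xi>. iprod (H \<xi>) (f \<xi>) (g j \<xi>)) \<in> borel_measurable M"
  by (simp add: measurable_vector_fields_def)

lemma vector_field_in_carrier:
  "\<lbrakk>f \<in> measurable_vector_fields M H g; \<xi> \<in> space M\<rbrakk> \<Longrightarrow> f \<xi> \<in> carrier (H \<xi>)"
  by (auto simp: measurable_vector_fields_def)

lemma fundamental_range: "\<xi> \<in> space M \<Longrightarrow> range (\<lambda>j. g j \<xi>) \<subseteq> carrier (H \<xi>)"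
  by (auto intro: fundamental_carrier)

lemma measurable_vector_field_fundamental: "g k \<in> measurable_vector_fields M H g"
  by (auto simp: measurable_vector_fields_def fundamental_carrier fundamental_measurable)

lemma measurable_vector_field_zero:
  "(\<lambda>\<xi>. \<zero>\<^bsub>H \<xi>\<^esub>) \<in> measurable_vector_fields M H g"
proof -
  have "\<zero>\<^bsub>H \<xi>\<^esub> \<in> carrier (H \<xi>)" "iprod (H \<xi>) \<zero>\<^bsub>H \<xi>\<^esub> (g j \<xi>) = 0" if "\<xi> \<in> space M" for \<xi> j
  proof -
    interpret complex_hilbert_space "H \<xi>" by (rule hilbert[OF that])
    show "\<zero>\<^bsub>H \<xi>\<^esub> \<in> carrier (H \<xi>)" "iprod (H \<xi>) \<zero>\<^bsub>H \<xi>\<^esub> (g j \<xi>) = 0"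
      using fundamental_carrier[OF that] by simp_all
  qed
  then show ?thesis
    by (simp add: measurable_vector_fields_def cong: measurable_cong)
qed

lemma measurable_vector_field_add:
  assumes "f \<in> measurable_vector_fields M H g" "h \<in> measurable_vector_fields M H g"
  shows "(\<lambda>\<xi>. f \<xi> \<oplus>\<^bsub>H \<xi>\<^esub> h \<xi>) \<in> measurable_vector_fields M H g"
proof -
  have "f \<xi> \<oplus>\<^bsub>H \<xi>\<^esub> h \<xi> \<in> carrier (H \<xi>)"
    "iprod (H \<xi>) (f \<xi> \<oplus>\<^bsub>H \<xi>\<^esub> h \<xi>) (g j \<xi>)
      = iprod (H \<xi>) (f \<xi>) (g j \<xi>) + iprod (H \<xi>) (h \<xi>) (g j \<xi>)"
    if "\<xi> \<in> space M" for \<xi> j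
  proof -
    interpret complex_hilbert_space "H \<xi>" by (rule hilbert[OF that])
    note [simp] = vector_field_in_carrier[OF assms(1) that] vector_field_in_carrier[OF assms(2) that]
      fundamental_carrier[OF that]
    show "f \<xi> \<oplus>\<^bsub>H \<xi>\<^esub> h \<xi> \<in> carrier (H \<xi>)"
      "iprod (H \<xi>) (f \<xi> \<oplus>\<^bsub>H \<xi>\<^esub> h \<xi>) (g j \<xi>)
        = iprod (H \<xi>) (f \<xi>) (g j \<xi>) + iprod (H \<xi>) (h \<xi>) (g j \<xi>)"
      by (simp_all add: iprod_add_left)
  qed
  then show ?thesis
    using iprod_measurable_fundamental[OF assms(1)] iprod_measurable_fundamental[OF assms(2)]
    by (simp add: measurable_vector_fields_def cong: measurable_cong)
qed

text \<open>The scalar may vary measurably with the point, as cut-offs by indicators and the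
  coefficients of rank-one fields require.\<close>

lemma measurable_vector_field_scale:
  assumes "f \<in> measurable_vector_fields M H g" "c \<in> borel_measurable M"
  shows "(\<lambda>\<xi>. c \<xi> \<odot>\<^bsub>H \<xi>\<^esub> f \<xi>) \<in> measurable_vector_fields M H g"
proof -
  have "c \<xi> \<odot>\<^bsub>H \<xi>\<^esub> f \<xi> \<in> carrier (H \<xi>)"
    "iprod (H \<xi>) (c \<xi> \<odot>\<^bsub>H \<xi>\<^esub> f \<xi>) (g j \<xi>) = c \<xi> * iprod (H \<xi>) (f \<xi>) (g j \<xi>)"
    if "\<xi> \<in> space M" for \<xi> j
  proof -
    interpret complex_hilbert_space "H \<xi>" by (rule hilbert[OF that])
    note [simp] = vector_field_in_carrier[OF assms(1) that] fundamental_carrier[OF that]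
    show "c \<xi> \<odot>\<^bsub>H \<xi>\<^esub> f \<xi> \<in> carrier (H \<xi>)"
      "iprod (H \<xi>) (c \<xi> \<odot>\<^bsub>H \<xi>\<^esub> f \<xi>) (g j \<xi>) = c \<xi> * iprod (H \<xi>) (f \<xi>) (g j \<xi>)"
      by (simp_all add: iprod_smult_left)
  qed
  then show ?thesis
    using iprod_measurable_fundamental[OF assms(1)] assms(2)
    by (simp add: measurable_vector_fields_def cong: measurable_cong)
qed

lemma measurable_vector_field_rat_comb:
  "(\<lambda>\<xi>. rat_comb (H \<xi>) (\<lambda>j. g j \<xi>) ps) \<in> measurable_vector_fields M H g"
proof (induction ps)
  case Nil
  then show ?case
    by (simp add: measurable_vector_field_zero)
next
  case (Cons p ps)
  obtain a b i where "p = (a, b, i)"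
    by (cases p)
  then show ?case
    using measurable_vector_field_add[OF measurable_vector_field_scale Cons]
    by (simp add: measurable_vector_field_fundamental)
qed

text \<open>Measurability of a field is tested only against the fundamental fields; conjugate
  linearity in the second argument extends the test along the list.\<close>

lemma iprod_measurable_rat_comb:
  assumes f: "f \<in> measurable_vector_fields M H g"
  shows "(\<lambda>\<xi>. iprod (H \<xi>) (f \<xi>) (rat_comb (H \<xi>) (\<lambda>j. g j \<xi>) ps)) \<in> borel_measurable M"
proof (induction ps)
  case Nil
  have "iprod (H \<xi>) (f \<xi>) \<zero>\<^bsub>H \<xi>\<^esub> = 0" if "\<xi> \<in> space M" for \<xi>
    using complex_hilbert_space.iprod_zero_right[OF hilbert[OF that]]
      vector_field_in_carrier[OF f that] .
  then show ?case
    by (simp cong: measurable_cong)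
next
  case (Cons p ps)
  obtain a b i where p: "p = (a, b, i)"
    by (cases p)
  have "iprod (H \<xi>) (f \<xi>) (rat_comb (H \<xi>) (\<lambda>j. g j \<xi>) (p # ps))
      = cnj (Complex (of_rat a) (of_rat b)) * iprod (H \<xi>) (f \<xi>) (g i \<xi>)
        + iprod (H \<xi>) (f \<xi>) (rat_comb (H \<xi>) (\<lambda>j. g j \<xi>) ps)"
    if "\<xi> \<in> space M" for \<xi>
  proof -
    interpret complex_hilbert_space "H \<xi>" by (rule hilbert[OF that])
    note [simp] = vector_field_in_carrier[OF f that] fundamental_carrier[OF that]
      rat_comb_closed[OF fundamental_range[OF that]]
    show ?thesis
      by (simp add: p iprod_simps)
  qed
  then show ?case
    using Cons iprod_measurable_fundamental[OF f] by (simp cong: measurable_cong)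
qed

text \<open>
  Since \<open>(hnorm x)\<^sup>2 - (hnorm (x - y))\<^sup>2 = 2 * Re (iprod x y) - Re (iprod y y)\<close>, the squared norm
  of a field is the supremum of the right-hand side over a countable dense family of measurable
  fields \<open>y\<close>.
\<close>

lemma hnorm_sq_measurable:
  assumes f: "f \<in> measurable_vector_fields M H g"
  shows "(\<lambda>\<xi>. (hnorm (H \<xi>) (f \<xi>))\<^sup>2) \<in> borel_measurable M"
  unfolding borel_measurable_iff_greater
proof
  fix t :: real
  let ?y = "\<lambda>ps \<xi>. rat_comb (H \<xi>) (\<lambda>j. g j \<xi>) ps"
  let ?F = "\<lambda>ps \<xi>. 2 * Re (iprod (H \<xi>) (f \<xi>) (?y ps \<xi>)) - Re (iprod (H \<xi>) (?y ps \<xi>) (?y ps \<xi>))"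
  have "t < (hnorm (H \<xi>) (f \<xi>))\<^sup>2 \<longleftrightarrow> (\<exists>ps. t < ?F ps \<xi>)" if \<xi>: "\<xi> \<in> space M" for \<xi>
  proof -
    interpret complex_hilbert_space "H \<xi>" by (rule hilbert[OF \<xi>])
    note [simp] = vector_field_in_carrier[OF f \<xi>] rat_comb_closed[OF fundamental_range[OF \<xi>]]
    have F: "?F ps \<xi> = (hnorm (H \<xi>) (f \<xi>))\<^sup>2 - (hnorm (H \<xi>) (f \<xi> \<ominus>\<^bsub>H \<xi>\<^esub> ?y ps \<xi>))\<^sup>2" for ps
      by (simp add: hnorm_minus_sq hnorm_sq[of "?y ps \<xi>"])
    show ?thesis
    proof
      assume t: "t < (hnorm (H \<xi>) (f \<xi>))\<^sup>2"
      \<comment> \<open>This accuracy makes the squared error smaller than the gap between the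
        squared norm and \<open>t\<close>.\<close>
      then have "0 < sqrt ((hnorm (H \<xi>) (f \<xi>))\<^sup>2 - t)"
        by simp
      then obtain ps where "hnorm (H \<xi>) (f \<xi> \<ominus>\<^bsub>H \<xi>\<^esub> ?y ps \<xi>) < sqrt ((hnorm (H \<xi>) (f \<xi>))\<^sup>2 - t)"
        using rat_comb_dense[OF fundamental_total[OF \<xi>] fundamental_range[OF \<xi>]] by fastforce
      then have "(hnorm (H \<xi>) (f \<xi> \<ominus>\<^bsub>H \<xi>\<^esub> ?y ps \<xi>))\<^sup>2 < (sqrt ((hnorm (H \<xi>) (f \<xi>))\<^sup>2 - t))\<^sup>2"
        by (intro power_strict_mono) simp_all
      then have "(hnorm (H \<xi>) (f \<xi> \<ominus>\<^bsub>H \<xi>\<^esub> ?y ps \<xi>))\<^sup>2 < (hnorm (H \<xi>) (f \<xi>))\<^sup>2 - t"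
        using t by simp
      then show "\<exists>ps. t < ?F ps \<xi>"
        unfolding F by (intro exI[of _ ps]) linarith
    next
      assume "\<exists>ps. t < ?F ps \<xi>"
      then obtain ps where "t < ?F ps \<xi>" ..
      then show "t < (hnorm (H \<xi>) (f \<xi>))\<^sup>2"
        unfolding F using zero_le_power2[of "hnorm (H \<xi>) (f \<xi> \<ominus>\<^bsub>H \<xi>\<^esub> ?y ps \<xi>)"] by linarith
    qed
  qed
  then have "{\<xi> \<in> space M. t < (hnorm (H \<xi>) (f \<xi>))\<^sup>2} = (\<Union>ps. {\<xi> \<in> space M. t < ?F ps \<xi>})"
    by blast
  also have "\<dots> \<in> sets M"
  proof -
    have [measurable]: "?F ps \<in> borel_measurable M" for ps
      using iprod_measurable_rat_comb[OF f]
        iprod_measurable_rat_comb[OF measurable_vector_field_rat_comb] by simp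
    have "{\<xi> \<in> space M. t < ?F ps \<xi>} \<in> sets M" for ps
      by measurable
    \<comment> \<open>The index type, lists over \<open>rat \<times> rat \<times> nat\<close>, is
      countable.\<close>
    then show ?thesis
      by (intro sets.countable_UN') auto
  qed
  finally show "{\<xi> \<in> space M. t < (hnorm (H \<xi>) (f \<xi>))\<^sup>2} \<in> sets M" .
qed

text \<open>The Gram criterion applied in each fibre to the fundamental sequence. The countable
  union shows that the set is measurable.\<close>

lemma two_le_hdim_set_eq:
  "{\<xi> \<in> space M. 2 \<le> hdim (H \<xi>)} =
   (\<Union>j. \<Union>k. {\<xi> \<in> space M. iprod (H \<xi>) (g j \<xi>) (g j \<xi>) * iprod (H \<xi>) (g k \<xi>) (g k \<xi>)
     \<noteq> iprod (H \<xi>) (g j \<xi>) (g k \<xi>) * iprod (H \<xi>) (g k \<xi>) (g j \<xi>)})"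
  using complex_hilbert_space.two_le_hdim_iff_gram[OF hilbert fundamental_total fundamental_range]
  by auto

section \<open>Sums and multiples of square-integrable fields\<close>

lemma square_integrable_add:
  assumes "f \<in> square_integrable_fields M H g" "h \<in> square_integrable_fields M H g"
  shows "(\<lambda>\<xi>. f \<xi> \<oplus>\<^bsub>H \<xi>\<^esub> h \<xi>) \<in> square_integrable_fields M H g"
proof -
  have f: "f \<in> measurable_vector_fields M H g" "integrable M (\<lambda>\<xi>. (hnorm (H \<xi>) (f \<xi>))\<^sup>2)"
    and h: "h \<in> measurable_vector_fields M H g" "integrable M (\<lambda>\<xi>. (hnorm (H \<xi>) (h \<xi>))\<^sup>2)"
    using assms by (simp_all add: square_integrable_fields_def)
  note fh = measurable_vector_field_add[OF f(1) h(1)]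
  have "integrable M (\<lambda>\<xi>. (hnorm (H \<xi>) (f \<xi> \<oplus>\<^bsub>H \<xi>\<^esub> h \<xi>))\<^sup>2)"
  proof (rule Bochner_Integration.integrable_bound)
    show "integrable M (\<lambda>\<xi>. 2 * (hnorm (H \<xi>) (f \<xi>))\<^sup>2 + 2 * (hnorm (H \<xi>) (h \<xi>))\<^sup>2)"
      using f h by simp
    show "AE \<xi> in M. norm ((hnorm (H \<xi>) (f \<xi> \<oplus>\<^bsub>H \<xi>\<^esub> h \<xi>))\<^sup>2)
        \<le> norm (2 * (hnorm (H \<xi>) (f \<xi>))\<^sup>2 + 2 * (hnorm (H \<xi>) (h \<xi>))\<^sup>2)"
      using complex_hilbert_space.hnorm_add_sq_le[OF hilbert
          vector_field_in_carrier[OF f(1)] vector_field_in_carrier[OF h(1)]]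
      by (intro AE_I2) simp
  qed (rule hnorm_sq_measurable[OF fh])
  then show ?thesis
    using fh by (simp add: square_integrable_fields_def)
qed

lemma square_integrable_scale:
  assumes "f \<in> square_integrable_fields M H g"
  shows "(\<lambda>\<xi>. a \<odot>\<^bsub>H \<xi>\<^esub> f \<xi>) \<in> square_integrable_fields M H g"
proof -
  have f: "f \<in> measurable_vector_fields M H g" "integrable M (\<lambda>\<xi>. (hnorm (H \<xi>) (f \<xi>))\<^sup>2)"
    using assms by (simp_all add: square_integrable_fields_def)
  have "hnorm (H \<xi>) (a \<odot>\<^bsub>H \<xi>\<^esub> f \<xi>) = cmod a * hnorm (H \<xi>) (f \<xi>)" if "\<xi> \<in> space M" for \<xi>
    using complex_hilbert_space.hnorm_smult[OF hilbert[OF that] vector_field_in_carrier[OF f(1) that]] .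
  then have "integrable M (\<lambda>\<xi>. (hnorm (H \<xi>) (a \<odot>\<^bsub>H \<xi>\<^esub> f \<xi>))\<^sup>2)"
    using f(2) by (simp add: power_mult_distrib cong: Bochner_Integration.integrable_cong)
  then show ?thesis
    using measurable_vector_field_scale[OF f(1), of "\<lambda>_. a"]
    by (simp add: square_integrable_fields_def)
qed

end

section \<open>Direct integrals and rank-one fields\<close>

context complex_hilbert_space
begin

text \<open>Both operators send a nonzero \<open>x\<close> to multiples of itself, and scalars
  commute; the zero vector is fixed by linearity.\<close>

lemma bounded_ops_commute_if_hdim_less_2:
  assumes "\<not> 2 \<le> hdim V" "S \<in> bounded_ops V" "T \<in> bounded_ops V" "x \<in> carrier V"
  shows "S (T x) = T (S x)"
proof -
  have S: "S \<in> carrier V \<rightarrow> carrier V" "\<And>a y. y \<in> carrier V \<Longrightarrow> S (a \<odot> y) = a \<odot> S y"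
    and T: "T \<in> carrier V \<rightarrow> carrier V" "\<And>a y. y \<in> carrier V \<Longrightarrow> T (a \<odot> y) = a \<odot> T y"
    using assms(2,3) by (auto simp: bounded_ops_def PiE_def)
  have Sx: "S x \<in> carrier V" and Tx: "T x \<in> carrier V"
    using S T assms(4) by auto
  have zero: "0 \<odot> y = \<zero>" if "y \<in> carrier V" for y
    using smult_l_null[OF that] by simp
  show ?thesis
  proof (cases "x = \<zero>")
    case True
    have "S \<zero> = \<zero>" "T \<zero> = \<zero>"
      using S(2)[of x 0] T(2)[of x 0] zero Sx Tx assms(4) True by simp_all
    then show ?thesis
      using True by simp
  next
    case False
    obtain a where a: "S x = a \<odot> x"
      using collinear_if_hdim_less_2[OF assms(1,4) Sx False] ..
    obtain b where b: "T x = b \<odot> x"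
      using collinear_if_hdim_less_2[OF assms(1,4) Tx False] ..
    have "S (T x) = b \<odot> (a \<odot> x)"
      using S(2)[OF assms(4)] a b by simp
    moreover have "T (S x) = a \<odot> (b \<odot> x)"
      using T(2)[OF assms(4)] a b by simp
    moreover have "b \<odot> (a \<odot> x) = a \<odot> (b \<odot> x)"
      using assms(4) by (intro eq_if_iprod_eq) (simp_all add: iprod_simps)
    ultimately show ?thesis
      by simp
  qed
qed

end

section \<open>Almost-everywhere classes and the operations of the direct integral\<close>

context measurable_hilbert_field
begin

abbreviation ae_class :: "('w \<Rightarrow> 'h) \<Rightarrow> ('w \<Rightarrow> 'h) set" where
  "ae_class f \<equiv> ae_rel M H g `` {f}"

lemma square_integrable_measurable:
  "f \<in> square_integrable_fields M H g \<Longrightarrow> f \<in> measurable_vector_fields M H g"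
  by (simp add: square_integrable_fields_def)

lemma square_integrable_in_carrier:
  "\<lbrakk>f \<in> square_integrable_fields M H g; \<xi> \<in> space M\<rbrakk> \<Longrightarrow> f \<xi> \<in> carrier (H \<xi>)"
  by (intro vector_field_in_carrier square_integrable_measurable)

lemma ae_rel_iff:
  "(f, h) \<in> ae_rel M H g \<longleftrightarrow> f \<in> square_integrable_fields M H g \<and>
     h \<in> square_integrable_fields M H g \<and> (AE \<xi> in M. f \<xi> = h \<xi>)"
  by (simp add: ae_rel_def)

lemma ae_class_self: "f \<in> square_integrable_fields M H g \<Longrightarrow> f \<in> ae_class f"
  by (simp add: ae_rel_iff)

lemma ae_class_eq_iff:
  assumes "f \<in> square_integrable_fields M H g" "h \<in> square_integrable_fields M H g"
  shows "ae_class f = ae_class h \<longleftrightarrow> (AE \<xi> in M. f \<xi> = h \<xi>)"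
proof
  assume "ae_class f = ae_class h"
  then have "h \<in> ae_class f"
    using ae_class_self[OF assms(2)] by simp
  then show "AE \<xi> in M. f \<xi> = h \<xi>"
    by (simp add: ae_rel_iff)
next
  assume eq: "AE \<xi> in M. f \<xi> = h \<xi>"
  have "(AE \<xi> in M. f \<xi> = k \<xi>) \<longleftrightarrow> (AE \<xi> in M. h \<xi> = k \<xi>)" for k
  proof
    assume "AE \<xi> in M. f \<xi> = k \<xi>"
    with eq show "AE \<xi> in M. h \<xi> = k \<xi>"
      by eventually_elim simp
  next
    assume "AE \<xi> in M. h \<xi> = k \<xi>"
    with eq show "AE \<xi> in M. f \<xi> = k \<xi>"
      by eventually_elim simp
  qed
  then show "ae_class f = ae_class h"
    using assms by (auto simp: ae_rel_iff)
qed

lemma direct_integral_carrier_iff: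
  "C \<in> carrier (direct_integral M H g) \<longleftrightarrow>
     (\<exists>f\<in>square_integrable_fields M H g. C = ae_class f)"
  by (auto simp: direct_integral_def quotient_def)

text \<open>Fibrewise addition respects almost-everywhere equality, so all terms in the union over
  representatives are the same class. Scalar multiples and operators below collapse in the same
  way.\<close>

lemma direct_integral_add:
  assumes f: "f \<in> square_integrable_fields M H g" and h: "h \<in> square_integrable_fields M H g"
  shows "ae_class f \<oplus>\<^bsub>direct_integral M H g\<^esub> ae_class h = ae_class (\<lambda>\<xi>. f \<xi> \<oplus>\<^bsub>H \<xi>\<^esub> h \<xi>)"
proof -
  have eq: "ae_class (\<lambda>\<xi>. f' \<xi> \<oplus>\<^bsub>H \<xi>\<^esub> h' \<xi>) = ae_class (\<lambda>\<xi>. f \<xi> \<oplus>\<^bsub>H \<xi>\<^esub> h \<xi>)"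
    if "f' \<in> ae_class f" "h' \<in> ae_class h" for f' h'
  proof -
    have f': "f' \<in> square_integrable_fields M H g" "AE \<xi> in M. f \<xi> = f' \<xi>"
      and h': "h' \<in> square_integrable_fields M H g" "AE \<xi> in M. h \<xi> = h' \<xi>"
      using that by (simp_all add: ae_rel_iff)
    have "AE \<xi> in M. f' \<xi> \<oplus>\<^bsub>H \<xi>\<^esub> h' \<xi> = f \<xi> \<oplus>\<^bsub>H \<xi>\<^esub> h \<xi>"
      using f'(2) h'(2) by eventually_elim simp
    then show ?thesis
      using ae_class_eq_iff[OF square_integrable_add[OF f'(1) h'(1)] square_integrable_add[OF f h]]
      by blast
  qed
  have "(\<Union>f'\<in>ae_class f. \<Union>h'\<in>ae_class h. ae_class (\<lambda>\<xi>. f' \<xi> \<oplus>\<^bsub>H \<xi>\<^esub> h' \<xi>))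
      = ae_class (\<lambda>\<xi>. f \<xi> \<oplus>\<^bsub>H \<xi>\<^esub> h \<xi>)"
    by (intro UN_constant_eq[OF ae_class_self] ballI eq f h)
  then show ?thesis
    by (simp only: direct_integral_def ring.simps)
qed

lemma direct_integral_smult:
  assumes f: "f \<in> square_integrable_fields M H g"
  shows "a \<odot>\<^bsub>direct_integral M H g\<^esub> ae_class f = ae_class (\<lambda>\<xi>. a \<odot>\<^bsub>H \<xi>\<^esub> f \<xi>)"
proof -
  have eq: "ae_class (\<lambda>\<xi>. a \<odot>\<^bsub>H \<xi>\<^esub> f' \<xi>) = ae_class (\<lambda>\<xi>. a \<odot>\<^bsub>H \<xi>\<^esub> f \<xi>)" if "f' \<in> ae_class f" for f'
  proof -
    have f': "f' \<in> square_integrable_fields M H g" "AE \<xi> in M. f \<xi> = f' \<xi>"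
      using that by (simp_all add: ae_rel_iff)
    have "AE \<xi> in M. a \<odot>\<^bsub>H \<xi>\<^esub> f' \<xi> = a \<odot>\<^bsub>H \<xi>\<^esub> f \<xi>"
      using f'(2) by eventually_elim simp
    then show ?thesis
      using ae_class_eq_iff[OF square_integrable_scale[OF f'(1)] square_integrable_scale[OF f]]
      by blast
  qed
  have "(\<Union>f'\<in>ae_class f. ae_class (\<lambda>\<xi>. a \<odot>\<^bsub>H \<xi>\<^esub> f' \<xi>)) = ae_class (\<lambda>\<xi>. a \<odot>\<^bsub>H \<xi>\<^esub> f \<xi>)"
    by (intro UN_constant_eq[OF ae_class_self] ballI eq f)
  then show ?thesis
    by (simp only: direct_integral_def module.simps)
qed

text \<open>The inner product of classes integrates an arbitrarily chosen representative
  \<open>k\<close>. Passing to \<open>f\<close> keeps the integral, since the squared norms are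
  measurable and agree almost everywhere.\<close>

lemma direct_integral_hnorm:
  assumes f: "f \<in> square_integrable_fields M H g"
  shows "hnorm (direct_integral M H g) (ae_class f) = sqrt (\<integral>\<xi>. (hnorm (H \<xi>) (f \<xi>))\<^sup>2 \<partial>M)"
proof -
  define k where "k = (SOME k. k \<in> ae_class f)"
  have "k \<in> ae_class f"
    unfolding k_def using ae_class_self[OF f] by (rule someI[where P = "\<lambda>k. k \<in> ae_class f"])
  then have k: "k \<in> square_integrable_fields M H g" "AE \<xi> in M. f \<xi> = k \<xi>"
    by (simp_all add: ae_rel_iff)
  have "iprod (direct_integral M H g) (ae_class f) (ae_class f) = (\<integral>\<xi>. iprod (H \<xi>) (k \<xi>) (k \<xi>) \<partial>M)"
    by (simp add: direct_integral_def k_def)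
  also have "\<dots> = (\<integral>\<xi>. complex_of_real ((hnorm (H \<xi>) (k \<xi>))\<^sup>2) \<partial>M)"
    by (intro Bochner_Integration.integral_cong refl complex_hilbert_space.iprod_self[OF hilbert]
        square_integrable_in_carrier[OF k(1)])
  also have "\<dots> = complex_of_real (\<integral>\<xi>. (hnorm (H \<xi>) (k \<xi>))\<^sup>2 \<partial>M)"
    by (rule integral_complex_of_real)
  also have "(\<integral>\<xi>. (hnorm (H \<xi>) (k \<xi>))\<^sup>2 \<partial>M) = (\<integral>\<xi>. (hnorm (H \<xi>) (f \<xi>))\<^sup>2 \<partial>M)"
  proof (rule integral_cong_AE)
    show "AE \<xi> in M. (hnorm (H \<xi>) (k \<xi>))\<^sup>2 = (hnorm (H \<xi>) (f \<xi>))\<^sup>2"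
      using k(2) by eventually_elim simp
  qed (intro hnorm_sq_measurable square_integrable_measurable f k)+
  finally show ?thesis
    by (simp add: hnorm_def)
qed

text \<open>The assumption on \<open>S\<close> matters because \<open>ae_rel\<close> relates only
  square-integrable fields: the class of any other image field would be empty.\<close>

lemma direct_integral_op_eq:
  assumes f: "f \<in> square_integrable_fields M H g"
    and S: "\<And>h. h \<in> square_integrable_fields M H g \<Longrightarrow>
      (\<lambda>\<xi>. S \<xi> (h \<xi>)) \<in> square_integrable_fields M H g"
  shows "direct_integral_op M H g S (ae_class f) = ae_class (\<lambda>\<xi>. S \<xi> (f \<xi>))"
proof -
  have eq: "ae_class (\<lambda>\<xi>. S \<xi> (h \<xi>)) = ae_class (\<lambda>\<xi>. S \<xi> (f \<xi>))" if "h \<in> ae_class f" for h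
  proof -
    have h: "h \<in> square_integrable_fields M H g" "AE \<xi> in M. f \<xi> = h \<xi>"
      using that by (simp_all add: ae_rel_iff)
    have "AE \<xi> in M. S \<xi> (h \<xi>) = S \<xi> (f \<xi>)"
      using h(2) by eventually_elim simp
    then show ?thesis
      using ae_class_eq_iff[OF S[OF h(1)] S[OF f]] by blast
  qed
  have "(\<Union>h\<in>ae_class f. ae_class (\<lambda>\<xi>. S \<xi> (h \<xi>))) = ae_class (\<lambda>\<xi>. S \<xi> (f \<xi>))"
    by (intro UN_constant_eq[OF ae_class_self] ballI eq f)
  moreover have "ae_class f \<in> carrier (direct_integral M H g)"
    using f by (auto simp: direct_integral_carrier_iff)
  ultimately show ?thesis
    by (simp only: direct_integral_op_def restrict_apply' simp_thms)
qed

text \<open>For an operator known only to preserve the carrier, the image field of \<open>f\<close>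
  itself need not be known to be square-integrable. The image class is nonempty, so a member of it
  arises from some representative \<open>f'\<close>, and almost-everywhere equalities lead back to
  \<open>f\<close>.\<close>

lemma direct_integral_op_representative:
  assumes f: "f \<in> square_integrable_fields M H g"
    and S: "direct_integral_op M H g S \<in>
      carrier (direct_integral M H g) \<rightarrow> carrier (direct_integral M H g)"
  obtains h where "h \<in> square_integrable_fields M H g"
    "direct_integral_op M H g S (ae_class f) = ae_class h" "AE \<xi> in M. h \<xi> = S \<xi> (f \<xi>)"
proof -
  have fc: "ae_class f \<in> carrier (direct_integral M H g)"
    using f by (auto simp: direct_integral_carrier_iff)
  have "direct_integral_op M H g S (ae_class f) \<in> carrier (direct_integral M H g)"
    using S fc by (rule funcset_mem)
  then obtain h where h: "h \<in> square_integrable_fields M H g"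
    "direct_integral_op M H g S (ae_class f) = ae_class h"
    unfolding direct_integral_carrier_iff by blast
  have "h \<in> direct_integral_op M H g S (ae_class f)"
    unfolding h(2) using h(1) by (rule ae_class_self)
  then obtain f' where "f' \<in> ae_class f" "h \<in> ae_class (\<lambda>\<xi>. S \<xi> (f' \<xi>))"
    using fc by (auto simp: direct_integral_op_def)
  then have "AE \<xi> in M. f \<xi> = f' \<xi>" "AE \<xi> in M. S \<xi> (f' \<xi>) = h \<xi>"
    by (simp_all add: ae_rel_iff)
  then have "AE \<xi> in M. h \<xi> = S \<xi> (f \<xi>)"
    by eventually_elim simp
  with h show thesis
    by (rule that)
qed

section \<open>Decomposable operators and rank-one fields\<close>

lemma operator_field_bounded_op:
  "\<lbrakk>S \<in> measurable_operator_fields M H g; \<xi> \<in> space M\<rbrakk> \<Longrightarrow> S \<xi> \<in> bounded_ops (H \<xi>)"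
  by (auto simp: measurable_operator_fields_def)

lemma operator_field_square_integrable:
  assumes S: "S \<in> measurable_operator_fields M H g"
    and C: "\<And>\<xi> x. \<lbrakk>\<xi> \<in> space M; x \<in> carrier (H \<xi>)\<rbrakk> \<Longrightarrow> hnorm (H \<xi>) (S \<xi> x) \<le> C * hnorm (H \<xi>) x"
    and f: "f \<in> square_integrable_fields M H g"
  shows "(\<lambda>\<xi>. S \<xi> (f \<xi>)) \<in> square_integrable_fields M H g"
    and "(\<integral>\<xi>. (hnorm (H \<xi>) (S \<xi> (f \<xi>)))\<^sup>2 \<partial>M) \<le> C\<^sup>2 * (\<integral>\<xi>. (hnorm (H \<xi>) (f \<xi>))\<^sup>2 \<partial>M)"
proof -
  have Sf: "(\<lambda>\<xi>. S \<xi> (f \<xi>)) \<in> measurable_vector_fields M H g"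
    using S square_integrable_measurable[OF f] by (auto simp: measurable_operator_fields_def)
  have int: "integrable M (\<lambda>\<xi>. C\<^sup>2 * (hnorm (H \<xi>) (f \<xi>))\<^sup>2)"
    using f by (simp add: square_integrable_fields_def)
  have le: "(hnorm (H \<xi>) (S \<xi> (f \<xi>)))\<^sup>2 \<le> C\<^sup>2 * (hnorm (H \<xi>) (f \<xi>))\<^sup>2" if "\<xi> \<in> space M" for \<xi>
  proof -
    interpret complex_hilbert_space "H \<xi>" by (rule hilbert[OF that])
    show ?thesis
      unfolding power_mult_distrib[symmetric]
      using C[OF that square_integrable_in_carrier[OF f that]]
        hnorm_nonneg[OF vector_field_in_carrier[OF Sf that]] by (rule power_mono)
  qed
  have int': "integrable M (\<lambda>\<xi>. (hnorm (H \<xi>) (S \<xi> (f \<xi>)))\<^sup>2)"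
    by (rule Bochner_Integration.integrable_bound[OF int hnorm_sq_measurable[OF Sf]])
      (use le in \<open>auto intro!: AE_I2\<close>)
  then show "(\<lambda>\<xi>. S \<xi> (f \<xi>)) \<in> square_integrable_fields M H g"
    using Sf by (simp add: square_integrable_fields_def)
  show "(\<integral>\<xi>. (hnorm (H \<xi>) (S \<xi> (f \<xi>)))\<^sup>2 \<partial>M) \<le> C\<^sup>2 * (\<integral>\<xi>. (hnorm (H \<xi>) (f \<xi>))\<^sup>2 \<partial>M)"
    using integral_mono[OF int' int le] by simp
qed

text \<open>Supplies members of the algebra: one bound valid on all fibres controls both the
  essential supremum of the operator norms and the norm on the direct integral.\<close>

lemma decomposable_op_if_uniformly_bounded:
  assumes S: "S \<in> measurable_operator_fields M H g" and "0 \<le> C"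
    and C: "\<And>\<xi> x. \<lbrakk>\<xi> \<in> space M; x \<in> carrier (H \<xi>)\<rbrakk> \<Longrightarrow> hnorm (H \<xi>) (S \<xi> x) \<le> C * hnorm (H \<xi>) x"
  shows "direct_integral_op M H g S \<in> decomposable_ops M H g"
proof -
  let ?D = "direct_integral M H g" and ?T = "direct_integral_op M H g S"
  note sq = operator_field_square_integrable(1)[OF S C]
  note le = operator_field_square_integrable(2)[OF S C]
  have T: "?T (ae_class f) = ae_class (\<lambda>\<xi>. S \<xi> (f \<xi>))" if "f \<in> square_integrable_fields M H g" for f
    using that sq by (rule direct_integral_op_eq)
  have "op_norm (H \<xi>) (S \<xi>) \<le> C" if "\<xi> \<in> space M" for \<xi>
  proof -
    interpret complex_hilbert_space "H \<xi>" by (rule hilbert[OF that])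
    show ?thesis
      unfolding op_norm_def
    proof (rule cSUP_least)
      \<comment> \<open>Bounding a real supremum requires a nonempty index set; the zero vector lies
        in the unit ball.\<close>
      have "\<zero>\<^bsub>H \<xi>\<^esub> \<in> {x \<in> carrier (H \<xi>). hnorm (H \<xi>) x \<le> 1}"
        by simp
      then show "{x \<in> carrier (H \<xi>). hnorm (H \<xi>) x \<le> 1} \<noteq> {}"
        by blast
    next
      fix x
      assume x: "x \<in> {x \<in> carrier (H \<xi>). hnorm (H \<xi>) x \<le> 1}"
      then have "hnorm (H \<xi>) (S \<xi> x) \<le> C * hnorm (H \<xi>) x"
        using C that by simp
      also have "\<dots> \<le> C"
        using x \<open>0 \<le> C\<close> by (simp add: mult_left_le)
      finally show "hnorm (H \<xi>) (S \<xi> x) \<le> C" .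
    qed
  qed
  then have "essentially_bounded M H S"
    unfolding essentially_bounded_def by (intro exI[of _ C] AE_I2)
  moreover have "?T \<in> bounded_ops ?D"
    unfolding bounded_ops_def
  proof (intro CollectI conjI ballI allI)
    have "?T x \<in> carrier ?D" if "x \<in> carrier ?D" for x
      using that sq T unfolding direct_integral_carrier_iff by blast
    moreover have "?T \<in> extensional (carrier ?D)"
      by (simp add: direct_integral_op_def)
    ultimately show "?T \<in> carrier ?D \<rightarrow>\<^sub>E carrier ?D"
      by (auto simp: PiE_def)
  next
    fix x y
    assume "x \<in> carrier ?D" "y \<in> carrier ?D"
    then obtain f h where f: "f \<in> square_integrable_fields M H g" "x = ae_class f"
      and h: "h \<in> square_integrable_fields M H g" "y = ae_class h"
      by (auto simp: direct_integral_carrier_iff)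
    have "S \<xi> (f \<xi> \<oplus>\<^bsub>H \<xi>\<^esub> h \<xi>) = S \<xi> (f \<xi>) \<oplus>\<^bsub>H \<xi>\<^esub> S \<xi> (h \<xi>)" if "\<xi> \<in> space M" for \<xi>
      using operator_field_bounded_op[OF S that] square_integrable_in_carrier[OF f(1) that]
        square_integrable_in_carrier[OF h(1) that] by (simp add: bounded_ops_def)
    then have "AE \<xi> in M. S \<xi> (f \<xi> \<oplus>\<^bsub>H \<xi>\<^esub> h \<xi>) = S \<xi> (f \<xi>) \<oplus>\<^bsub>H \<xi>\<^esub> S \<xi> (h \<xi>)"
      by (rule AE_I2)
    then show "?T (x \<oplus>\<^bsub>?D\<^esub> y) = ?T x \<oplus>\<^bsub>?D\<^esub> ?T y"
      using f h by (simp add: direct_integral_add T square_integrable_add sq ae_class_eq_iff)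
  next
    fix a x
    assume "x \<in> carrier ?D"
    then obtain f where f: "f \<in> square_integrable_fields M H g" "x = ae_class f"
      by (auto simp: direct_integral_carrier_iff)
    have "S \<xi> (a \<odot>\<^bsub>H \<xi>\<^esub> f \<xi>) = a \<odot>\<^bsub>H \<xi>\<^esub> S \<xi> (f \<xi>)" if "\<xi> \<in> space M" for \<xi>
      using operator_field_bounded_op[OF S that] square_integrable_in_carrier[OF f(1) that]
      by (simp add: bounded_ops_def)
    then have "AE \<xi> in M. S \<xi> (a \<odot>\<^bsub>H \<xi>\<^esub> f \<xi>) = a \<odot>\<^bsub>H \<xi>\<^esub> S \<xi> (f \<xi>)"
      by (rule AE_I2)
    then show "?T (a \<odot>\<^bsub>?D\<^esub> x) = a \<odot>\<^bsub>?D\<^esub> ?T x"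
      using f by (simp add: direct_integral_smult T square_integrable_scale sq ae_class_eq_iff)
  next
    show "\<exists>C. \<forall>x\<in>carrier ?D. hnorm ?D (?T x) \<le> C * hnorm ?D x"
    proof (intro exI[of _ C] ballI)
      fix x
      assume "x \<in> carrier ?D"
      then obtain f where f: "f \<in> square_integrable_fields M H g" "x = ae_class f"
        by (auto simp: direct_integral_carrier_iff)
      have "sqrt (\<integral>\<xi>. (hnorm (H \<xi>) (S \<xi> (f \<xi>)))\<^sup>2 \<partial>M) \<le> sqrt (C\<^sup>2 * (\<integral>\<xi>. (hnorm (H \<xi>) (f \<xi>))\<^sup>2 \<partial>M))"
        using le[OF _ _ f(1)] by simp
      then show "hnorm ?D (?T x) \<le> C * hnorm ?D x"
        using f \<open>0 \<le> C\<close> by (simp add: T sq direct_integral_hnorm real_sqrt_mult)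
    qed
  qed
  ultimately show ?thesis
    using S by (auto simp: decomposable_ops_def)
qed

text \<open>The cut-off to \<open>E\<close> permits a uniform bound even if the fundamental fields
  are unbounded. Restriction to the carrier is forced by the extensional function space in
  \<open>bounded_ops\<close>.\<close>

definition rank_one_field :: "'w set \<Rightarrow> nat \<Rightarrow> nat \<Rightarrow> 'w \<Rightarrow> 'h \<Rightarrow> 'h" where
  "rank_one_field E j k \<xi> =
     (\<lambda>x\<in>carrier (H \<xi>). (indicator E \<xi> * iprod (H \<xi>) x (g j \<xi>)) \<odot>\<^bsub>H \<xi>\<^esub> g k \<xi>)"

lemma rank_one_field_apply:
  "x \<in> carrier (H \<xi>) \<Longrightarrow>
   rank_one_field E j k \<xi> x = (indicator E \<xi> * iprod (H \<xi>) x (g j \<xi>)) \<odot>\<^bsub>H \<xi>\<^esub> g k \<xi>"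
  by (simp add: rank_one_field_def)

text \<open>Cauchy-Schwarz yields one factor \<open>K\<close> through \<open>g j\<close>, the vector
  \<open>g k\<close> yields another; off \<open>E\<close> the image is zero.\<close>

lemma rank_one_field_bound:
  assumes \<xi>: "\<xi> \<in> space M" and x: "x \<in> carrier (H \<xi>)" and "0 \<le> K"
    and K: "\<And>\<xi>. \<xi> \<in> E \<Longrightarrow> hnorm (H \<xi>) (g j \<xi>) \<le> K \<and> hnorm (H \<xi>) (g k \<xi>) \<le> K"
  shows "hnorm (H \<xi>) (rank_one_field E j k \<xi> x) \<le> K\<^sup>2 * hnorm (H \<xi>) x"
proof -
  interpret complex_hilbert_space "H \<xi>" by (rule hilbert[OF \<xi>])
  note [simp] = fundamental_carrier[OF \<xi>]
  show ?thesis
  proof (cases "\<xi> \<in> E")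
    case True
    have "cmod (iprod (H \<xi>) x (g j \<xi>)) * hnorm (H \<xi>) (g k \<xi>)
        \<le> (hnorm (H \<xi>) x * hnorm (H \<xi>) (g j \<xi>)) * hnorm (H \<xi>) (g k \<xi>)"
      using x by (intro mult_right_mono cauchy_schwarz) simp_all
    also have "\<dots> \<le> (hnorm (H \<xi>) x * K) * K"
      using x K[OF True] \<open>0 \<le> K\<close> by (intro mult_mono mult_nonneg_nonneg) simp_all
    finally show ?thesis
      using x True by (simp add: rank_one_field_apply hnorm_smult power2_eq_square mult_ac)
  next
    case False
    then show ?thesis
      using x \<open>0 \<le> K\<close> by (simp add: rank_one_field_apply hnorm_smult)
  qed
qed

lemma rank_one_field_measurable:
  assumes E: "E \<in> sets M" and "0 \<le> K"
    and K: "\<And>\<xi>. \<xi> \<in> E \<Longrightarrow> hnorm (H \<xi>) (g j \<xi>) \<le> K \<and> hnorm (H \<xi>) (g k \<xi>) \<le> K"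
  shows "rank_one_field E j k \<in> measurable_operator_fields M H g"
proof -
  have "rank_one_field E j k \<xi> \<in> bounded_ops (H \<xi>)" if \<xi>: "\<xi> \<in> space M" for \<xi>
  proof -
    interpret complex_hilbert_space "H \<xi>" by (rule hilbert[OF \<xi>])
    note [simp] = fundamental_carrier[OF \<xi>]
    show ?thesis
      unfolding bounded_ops_def
    proof (intro CollectI conjI ballI allI)
      show "rank_one_field E j k \<xi> \<in> carrier (H \<xi>) \<rightarrow>\<^sub>E carrier (H \<xi>)"
        by (auto simp: rank_one_field_def)
      show "\<exists>C. \<forall>x\<in>carrier (H \<xi>). hnorm (H \<xi>) (rank_one_field E j k \<xi> x) \<le> C * hnorm (H \<xi>) x"
        using rank_one_field_bound[OF \<xi> _ \<open>0 \<le> K\<close> K] by blast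
    qed (intro eq_if_iprod_eq;
      simp add: rank_one_field_apply iprod_simps algebra_simps)+
  qed
  moreover have "(\<lambda>\<xi>. rank_one_field E j k \<xi> (f \<xi>)) \<in> measurable_vector_fields M H g"
    if f: "f \<in> measurable_vector_fields M H g" for f
  proof -
    have "(\<lambda>\<xi>. (indicator E \<xi> * iprod (H \<xi>) (f \<xi>) (g j \<xi>)) \<odot>\<^bsub>H \<xi>\<^esub> g k \<xi>)
        \<in> measurable_vector_fields M H g"
      using E iprod_measurable_fundamental[OF f]
      by (intro measurable_vector_field_scale measurable_vector_field_fundamental) simp
    then show ?thesis
      using vector_field_in_carrier[OF f]
      by (simp add: measurable_vector_fields_def rank_one_field_apply Pi_def cong: measurable_cong)
  qed
  ultimately show ?thesis
    by (auto simp: measurable_operator_fields_def)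
qed

text \<open>The bound \<open>K\<close> puts both rank-one operators into the algebra and, with the
  finite measure of \<open>E\<close>, the cut-off of \<open>g j\<close> into the direct integral.
  Commutation gives a fibrewise identity almost everywhere, which the Gram determinant excludes on
  \<open>E\<close>.\<close>

lemma gram_nonzero_null_if_commutative:
  assumes comm: "commutative_ops (direct_integral M H g) (decomposable_ops M H g)"
    and E: "E \<in> sets M" "emeasure M E < \<infinity>" and "0 \<le> K"
    and K: "\<And>\<xi>. \<xi> \<in> E \<Longrightarrow> hnorm (H \<xi>) (g j \<xi>) \<le> K \<and> hnorm (H \<xi>) (g k \<xi>) \<le> K"
    and gram: "\<And>\<xi>. \<xi> \<in> E \<Longrightarrow> iprod (H \<xi>) (g j \<xi>) (g j \<xi>) * iprod (H \<xi>) (g k \<xi>) (g k \<xi>)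
      \<noteq> iprod (H \<xi>) (g j \<xi>) (g k \<xi>) * iprod (H \<xi>) (g k \<xi>) (g j \<xi>)"
  shows "E \<in> null_sets M"
proof -
  let ?D = "direct_integral M H g"
  let ?S = "rank_one_field E j k" and ?T = "rank_one_field E k j"
  have K': "\<And>\<xi>. \<xi> \<in> E \<Longrightarrow> hnorm (H \<xi>) (g k \<xi>) \<le> K \<and> hnorm (H \<xi>) (g j \<xi>) \<le> K"
    using K by blast
  note S = rank_one_field_measurable[OF E(1) \<open>0 \<le> K\<close> K]
  note T = rank_one_field_measurable[OF E(1) \<open>0 \<le> K\<close> K']
  note Sb = rank_one_field_bound[OF _ _ \<open>0 \<le> K\<close> K] and Tb = rank_one_field_bound[OF _ _ \<open>0 \<le> K\<close> K']
  have Ssq: "(\<lambda>\<xi>. ?S \<xi> (h \<xi>)) \<in> square_integrable_fields M H g"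
    if "h \<in> square_integrable_fields M H g" for h
    using operator_field_square_integrable(1)[OF S Sb that] .
  have Tsq: "(\<lambda>\<xi>. ?T \<xi> (h \<xi>)) \<in> square_integrable_fields M H g"
    if "h \<in> square_integrable_fields M H g" for h
    using operator_field_square_integrable(1)[OF T Tb that] .
  \<comment> \<open>The test field is \<open>g j\<close> cut off to \<open>E\<close>; its squared
    norm is at most \<open>K\<^sup>2\<close> times the indicator of \<open>E\<close>.\<close>
  define f where "f = (\<lambda>\<xi>. indicator E \<xi> \<odot>\<^bsub>H \<xi>\<^esub> g j \<xi>)"
  have fm: "f \<in> measurable_vector_fields M H g"
    unfolding f_def using E(1)
    by (intro measurable_vector_field_scale measurable_vector_field_fundamental) simp
  have "integrable M (\<lambda>\<xi>. (hnorm (H \<xi>) (f \<xi>))\<^sup>2)"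
  proof (rule Bochner_Integration.integrable_bound[OF _ hnorm_sq_measurable[OF fm]])
    show "integrable M (\<lambda>\<xi>. K\<^sup>2 * indicator E \<xi> :: real)"
      using E by simp
    have "(hnorm (H \<xi>) (f \<xi>))\<^sup>2 \<le> K\<^sup>2 * indicator E \<xi>" if \<xi>: "\<xi> \<in> space M" for \<xi>
    proof -
      interpret complex_hilbert_space "H \<xi>" by (rule hilbert[OF \<xi>])
      show ?thesis
        using K[of \<xi>] fundamental_carrier[OF \<xi>]
        by (auto simp: f_def hnorm_smult indicator_def intro!: power_mono)
    qed
    then show "AE \<xi> in M. norm ((hnorm (H \<xi>) (f \<xi>))\<^sup>2) \<le> norm (K\<^sup>2 * indicator E \<xi> :: real)"
      by (intro AE_I2) simp
  qed
  then have f: "f \<in> square_integrable_fields M H g"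
    using fm by (simp add: square_integrable_fields_def)
  then have fc: "ae_class f \<in> carrier ?D"
    by (auto simp: direct_integral_carrier_iff)
  have "direct_integral_op M H g ?S \<in> decomposable_ops M H g"
    "direct_integral_op M H g ?T \<in> decomposable_ops M H g"
    using decomposable_op_if_uniformly_bounded[OF S _ Sb]
      decomposable_op_if_uniformly_bounded[OF T _ Tb] by simp_all
  then have "compose (carrier ?D) (direct_integral_op M H g ?S) (direct_integral_op M H g ?T) (ae_class f)
      = compose (carrier ?D) (direct_integral_op M H g ?T) (direct_integral_op M H g ?S) (ae_class f)"
    using comm by (simp add: commutative_ops_def)
  then have "ae_class (\<lambda>\<xi>. ?S \<xi> (?T \<xi> (f \<xi>))) = ae_class (\<lambda>\<xi>. ?T \<xi> (?S \<xi> (f \<xi>)))"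
    using f fc Ssq Tsq by (simp add: compose_eq direct_integral_op_eq)
  then have ae: "AE \<xi> in M. ?S \<xi> (?T \<xi> (f \<xi>)) = ?T \<xi> (?S \<xi> (f \<xi>))"
    using ae_class_eq_iff[OF Ssq[OF Tsq[OF f]] Tsq[OF Ssq[OF f]]] by blast
  have neq: "?S \<xi> (?T \<xi> (f \<xi>)) \<noteq> ?T \<xi> (?S \<xi> (f \<xi>))" if \<xi>: "\<xi> \<in> space M" "\<xi> \<in> E" for \<xi>
  proof
    interpret complex_hilbert_space "H \<xi>" by (rule hilbert[OF \<xi>(1)])
    note [simp] = fundamental_carrier[OF \<xi>(1)]
    let ?i = "\<lambda>a b. iprod (H \<xi>) (g a \<xi>) (g b \<xi>)"
    assume "?S \<xi> (?T \<xi> (f \<xi>)) = ?T \<xi> (?S \<xi> (f \<xi>))"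
    \<comment> \<open>With u = \<open>g j\<close> and v = \<open>g k\<close>, the left product is
      <u,v><u,u> times v and the right one <u,u><v,v> times u. Pairing with u and cancelling <u,u>
      makes the Gram determinant zero.\<close>
    then have "iprod (H \<xi>) (?S \<xi> (?T \<xi> (f \<xi>))) (g j \<xi>) = iprod (H \<xi>) (?T \<xi> (?S \<xi> (f \<xi>))) (g j \<xi>)"
      by simp
    then have "?i j k * ?i j j * ?i k j = ?i j j * ?i k k * ?i j j"
      using \<xi>(2) by (simp add: rank_one_field_apply f_def iprod_simps)
    \<comment> \<open>Otherwise \<open>g j\<close> would vanish in this fibre, and the Gram
      determinant with it.\<close>
    moreover have "?i j j \<noteq> 0"
      using gram[OF \<xi>(2)] by (auto simp: iprod_self_eq_0_iff)
    ultimately show False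
      using gram[OF \<xi>(2)] by (simp add: mult_ac)
  qed
  have "AE \<xi> in M. \<xi> \<notin> E"
    using ae AE_space by eventually_elim (use neq in blast)
  then show ?thesis
    using AE_iff_null_sets[OF E(1)] by blast
qed

end

section \<open>Commutativity and the size of the set of fibres of dimension at least two\<close>

theorem proposition3p2:
  fixes M :: "'w measure" and H :: "'w \<Rightarrow> 'h hilbert" and g :: "nat \<Rightarrow> 'w \<Rightarrow> 'h"
  assumes "sigma_finite_measure M"
    and "measurable_hilbert_field M H g"
    and "\<And>\<xi>. \<xi> \<in> space M \<Longrightarrow> separable_space (htopology (H \<xi>))"
    and "\<And>\<xi>. \<xi> \<in> space M \<Longrightarrow> carrier (H \<xi>) \<noteq> {\<zero>\<^bsub>H \<xi>\<^esub>}"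
  shows "commutative_ops (direct_integral M H g) (decomposable_ops M H g) \<longleftrightarrow>
         {\<xi> \<in> space M. 2 \<le> hdim (H \<xi>)} \<in> null_sets M"
proof -
  interpret measurable_hilbert_field M H g by fact
  interpret sigma_finite_measure M by fact
  let ?D = "direct_integral M H g"
  show ?thesis
  proof
    assume comm: "commutative_ops ?D (decomposable_ops M H g)"
    obtain A :: "nat \<Rightarrow> 'w set" where A: "range A \<subseteq> sets M" "(\<Union>i. A i) = space M"
      "\<And>i. emeasure M (A i) \<noteq> \<infinity>"
      using sigma_finite by metis
    define G where "G j k = {\<xi> \<in> space M.
      iprod (H \<xi>) (g j \<xi>) (g j \<xi>) * iprod (H \<xi>) (g k \<xi>) (g k \<xi>)
        \<noteq> iprod (H \<xi>) (g j \<xi>) (g k \<xi>) * iprod (H \<xi>) (g k \<xi>) (g j \<xi>)}" for j k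
    \<comment> \<open>The bound is put on squares because measurability is established for the
      squared norm.\<close>
    define B where "B j n = {\<xi> \<in> space M. (hnorm (H \<xi>) (g j \<xi>))\<^sup>2 \<le> (real n)\<^sup>2}" for j n
    have G: "G j k \<in> sets M" for j k
      unfolding G_def using fundamental_measurable[measurable] by measurable
    have B: "B j n \<in> sets M" for j n
      unfolding B_def
      using hnorm_sq_measurable[OF measurable_vector_field_fundamental, measurable] by measurable
    have null: "A i \<inter> G j k \<inter> (B j n \<inter> B k n) \<in> null_sets M" for i j k n
    proof (rule gram_nonzero_null_if_commutative[OF comm, where K = "real n" and j = j and k = k])
      show sets: "A i \<inter> G j k \<inter> (B j n \<inter> B k n) \<in> sets M"
        using A(1) G B by blast
      have "emeasure M (A i \<inter> G j k \<inter> (B j n \<inter> B k n)) \<le> emeasure M (A i)"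
        using A(1) by (intro emeasure_mono) auto
      then show "emeasure M (A i \<inter> G j k \<inter> (B j n \<inter> B k n)) < \<infinity>"
        using A(3)[of i] by (simp add: less_top order.strict_trans1)
    next
      fix \<xi>
      assume "\<xi> \<in> A i \<inter> G j k \<inter> (B j n \<inter> B k n)"
      then show "hnorm (H \<xi>) (g j \<xi>) \<le> real n \<and> hnorm (H \<xi>) (g k \<xi>) \<le> real n"
        unfolding B_def by (auto intro: power2_le_imp_le)
    qed (auto simp: G_def)
    have "{\<xi> \<in> space M. 2 \<le> hdim (H \<xi>)} \<subseteq> (\<Union>i. \<Union>j. \<Union>k. \<Union>n. A i \<inter> G j k \<inter> (B j n \<inter> B k n))"
    proof
      fix \<xi>
      assume "\<xi> \<in> {\<xi> \<in> space M. 2 \<le> hdim (H \<xi>)}"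
      then obtain j k where jk: "\<xi> \<in> G j k" "\<xi> \<in> space M"
        unfolding two_le_hdim_set_eq G_def by blast
      obtain i where i: "\<xi> \<in> A i"
        using A(2) jk(2) by blast
      \<comment> \<open>One integer bounds both norms, so a single index \<open>n\<close> serves
        both fields.\<close>
      obtain n where n: "max (hnorm (H \<xi>) (g j \<xi>)) (hnorm (H \<xi>) (g k \<xi>)) \<le> real n"
        using real_arch_simple by blast
      have "\<xi> \<in> B j n \<inter> B k n"
        using n jk(2) complex_hilbert_space.hnorm_nonneg[OF hilbert fundamental_carrier]
        unfolding B_def by (auto intro: power_mono)
      with i jk show "\<xi> \<in> (\<Union>i. \<Union>j. \<Union>k. \<Union>n. A i \<inter> G j k \<inter> (B j n \<inter> B k n))"
        by blast
    qed
    moreover have "(\<Union>i. \<Union>j. \<Union>k. \<Union>n. A i \<inter> G j k \<inter> (B j n \<inter> B k n)) \<in> null_sets M"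
      by (intro null_sets_UN null)
    \<comment> \<open>\<open>M\<close> need not be complete, so inclusion in a null set does not
      suffice; measurability comes from the Gram description.\<close>
    moreover have "{\<xi> \<in> space M. 2 \<le> hdim (H \<xi>)} \<in> sets M"
      unfolding two_le_hdim_set_eq using G unfolding G_def by blast
    ultimately show "{\<xi> \<in> space M. 2 \<le> hdim (H \<xi>)} \<in> null_sets M"
      by (rule null_sets_subset[rotated 2])
  next
    assume null: "{\<xi> \<in> space M. 2 \<le> hdim (H \<xi>)} \<in> null_sets M"
    show "commutative_ops ?D (decomposable_ops M H g)"
      unfolding commutative_ops_def
    proof (intro ballI ext)
      fix S T C
      assume "S \<in> decomposable_ops M H g" "T \<in> decomposable_ops M H g"
      then obtain s t where s: "s \<in> measurable_operator_fields M H g" "S = direct_integral_op M H g s"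
        and t: "t \<in> measurable_operator_fields M H g" "T = direct_integral_op M H g t"
        and maps: "direct_integral_op M H g s \<in> carrier ?D \<rightarrow> carrier ?D"
          "direct_integral_op M H g t \<in> carrier ?D \<rightarrow> carrier ?D"
        by (auto simp: decomposable_ops_def bounded_ops_def PiE_def)
      show "compose (carrier ?D) S T C = compose (carrier ?D) T S C"
      proof (cases "C \<in> carrier ?D")
        case True
        then obtain f where f: "f \<in> square_integrable_fields M H g" "C = ae_class f"
          by (auto simp: direct_integral_carrier_iff)
        \<comment> \<open>The fields \<open>h\<close> and \<open>k\<close> represent
          \<open>T C\<close> and \<open>S (T C)\<close>, the fields \<open>h'\<close> and
          \<open>k'\<close> represent \<open>S C\<close> and \<open>T (S C)\<close>; each is tied to
          the operator fields only almost everywhere.\<close>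
        obtain h where h: "h \<in> square_integrable_fields M H g" "T C = ae_class h"
          "AE \<xi> in M. h \<xi> = t \<xi> (f \<xi>)"
          using direct_integral_op_representative[OF f(1) maps(2)] t f by metis
        obtain k where k: "k \<in> square_integrable_fields M H g" "S (T C) = ae_class k"
          "AE \<xi> in M. k \<xi> = s \<xi> (h \<xi>)"
          using direct_integral_op_representative[OF h(1) maps(1)] s h by metis
        obtain h' where h': "h' \<in> square_integrable_fields M H g" "S C = ae_class h'"
          "AE \<xi> in M. h' \<xi> = s \<xi> (f \<xi>)"
          using direct_integral_op_representative[OF f(1) maps(1)] s f by metis
        obtain k' where k': "k' \<in> square_integrable_fields M H g" "T (S C) = ae_class k'"
          "AE \<xi> in M. k' \<xi> = t \<xi> (h' \<xi>)"
          using direct_integral_op_representative[OF h'(1) maps(2)] t h' by metis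
        have "AE \<xi> in M. s \<xi> (t \<xi> (f \<xi>)) = t \<xi> (s \<xi> (f \<xi>))"
          using AE_not_in[OF null] AE_space
        proof eventually_elim
          case (elim \<xi>)
          then show ?case
            using complex_hilbert_space.bounded_ops_commute_if_hdim_less_2[OF hilbert]
              operator_field_bounded_op s(1) t(1) square_integrable_in_carrier[OF f(1)] by blast
        qed
        \<comment> \<open>Almost everywhere \<open>k\<close> is s applied to \<open>h\<close>, hence
          s t applied to \<open>f\<close>, hence t s applied to \<open>f\<close>, hence t applied to
          \<open>h'\<close>, which is \<open>k'\<close>.\<close>
        with h(3) k(3) h'(3) k'(3) have "AE \<xi> in M. k \<xi> = k' \<xi>"
          by eventually_elim simp
        then show ?thesis
          using True k k' by (simp add: compose_eq ae_class_eq_iff)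
      \<comment> \<open>Off the carrier both composites take the default value
        \<open>undefined\<close>.\<close>
      qed (simp add: compose_def)
    qed
  qed
qed

end
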